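(* Let $n$ be a square-free even positive integer such that $n^{2}+1 = q$ for some prime $q$, and let $E_{n}: y^{2} = x(x-1)(x+n^{2})$. For $k\in\{1,5\}$ let $\Omega_{k,n}$ denote the number of prime factors of $n$ congruent to $k \pmod 8$. Then $s^{(2)}(E_{n}/\mathbb{Q}) = \Omega_{1,n} + \Omega_{5,n}$.
   Context: $S^{(2)}(E_n/\mathbb{Q})$ denotes the $2$-Selmer group of $E_n$ over $\mathbb{Q}$. The $2$-Selmer rank $s^{(2)}(E_n/\mathbb{Q})$ is defined by $|S^{(2)}(E_n/\mathbb{Q})| = 2^{2+s^{(2)}(E_n/\mathbb{Q})}$, i.e. it is the $\mathbb{F}_2$-dimension of the quotient of $S^{(2)}(E_n/\mathbb{Q})$ by the (order $4$) image of $E_n(\mathbb{Q})_{\mathrm{tors}}$ under the $2$-descent map. *)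

theory Defs
  imports Complex_Main "HOL-Algebra.Algebra" "HOL-Algebra.Algebraic_Closure_Type"
    "HOL-Computational_Algebra.Computational_Algebra"
begin

section \<open>The field of p-adic numbers\<close>

definition padic_val :: "nat \<Rightarrow> rat \<Rightarrow> int" where
  "padic_val p x = int (multiplicity (int p) (fst (quotient_of x)))
                 - int (multiplicity (int p) (snd (quotient_of x)))"

definition padic_abs :: "nat \<Rightarrow> rat \<Rightarrow> real" where
  "padic_abs p x = (if x = 0 then 0 else real p powi (- padic_val p x))"

text \<open>The completion of the rationals with respect to the p-adic absolute value: Cauchy sequences
  modulo null sequences.\<close>

definition padic_cauchy :: "nat \<Rightarrow> (nat \<Rightarrow> rat) set" where
  "padic_cauchy p =
     {f. \<forall>\<epsilon>>0. \<exists>N. \<forall>i\<ge>N. \<forall>j\<ge>N. padic_abs p (f i - f j) < \<epsilon>}"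

definition padic_null :: "nat \<Rightarrow> (nat \<Rightarrow> rat) set" where
  "padic_null p = {f. (\<lambda>i. padic_abs p (f i)) \<longlonglongrightarrow> 0}"

definition padic_cauchy_ring :: "nat \<Rightarrow> (nat \<Rightarrow> rat) ring" where
  "padic_cauchy_ring p =
     \<lparr>carrier = padic_cauchy p, monoid.mult = (\<lambda>f g i. f i * g i), one = (\<lambda>i. 1),
      ring.zero = (\<lambda>i. 0), add = (\<lambda>f g i. f i + g i)\<rparr>"

definition Qp :: "nat \<Rightarrow> (nat \<Rightarrow> rat) set ring" where
  "Qp p = padic_cauchy_ring p Quot padic_null p"

definition Qp_of_rat :: "nat \<Rightarrow> rat \<Rightarrow> (nat \<Rightarrow> rat) set" where
  "Qp_of_rat p x = padic_null p +>\<^bsub>padic_cauchy_ring p\<^esub> (\<lambda>i. x)"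

section \<open>The 2-descent map\<close>

text \<open>The elliptic curves considered are \<open>E: y\<^sup>2 = (x - e1) (x - e2) (x - e3)\<close> with pairwise distinct
  \<open>e1\<close>, \<open>e2\<close>, \<open>e3\<close> in the field \<open>K\<close>.\<close>

datatype 'a point = Infinity | Affine 'a 'a

definition curve_points :: "('a, 'b) ring_scheme \<Rightarrow> 'a \<Rightarrow> 'a \<Rightarrow> 'a \<Rightarrow> 'a point set" where
  "curve_points K e1 e2 e3 = insert Infinity
     {Affine x y | x y. x \<in> carrier K \<and> y \<in> carrier K \<and>
        y \<otimes>\<^bsub>K\<^esub> y = (x \<ominus>\<^bsub>K\<^esub> e1) \<otimes>\<^bsub>K\<^esub> (x \<ominus>\<^bsub>K\<^esub> e2) \<otimes>\<^bsub>K\<^esub> (x \<ominus>\<^bsub>K\<^esub> e3)}"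

definition unit_squares :: "('a, 'b) ring_scheme \<Rightarrow> 'a set" where
  "unit_squares K = (\<lambda>u. u \<otimes>\<^bsub>K\<^esub> u) ` Units K"

text \<open>The class of \<open>a\<close> in \<open>K\<^sup>* / (K\<^sup>*)\<^sup>2\<close>, that is, an element of the carrier of
  \<open>units_of K Mod unit_squares K\<close>.\<close>

definition square_class :: "('a, 'b) ring_scheme \<Rightarrow> 'a \<Rightarrow> 'a set" where
  "square_class K a = unit_squares K #>\<^bsub>units_of K\<^esub> a"

text \<open>The component of the 2-descent map at the 2-torsion point \<open>(e, 0)\<close>, where \<open>e'\<close> and \<open>e''\<close>
  are the other two roots: it is the class of \<open>x - e\<close>, except at the point \<open>(e, 0)\<close> itself.\<close>

fun descent_component :: "('a, 'b) ring_scheme \<Rightarrow> 'a \<Rightarrow> 'a \<Rightarrow> 'a \<Rightarrow> 'a point \<Rightarrow> 'a set" where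
  "descent_component K e e' e'' Infinity = square_class K \<one>\<^bsub>K\<^esub>"
| "descent_component K e e' e'' (Affine x y) = square_class K
     (if x = e then (e \<ominus>\<^bsub>K\<^esub> e') \<otimes>\<^bsub>K\<^esub> (e \<ominus>\<^bsub>K\<^esub> e'') else x \<ominus>\<^bsub>K\<^esub> e)"

text \<open>The complete 2-descent map \<open>E(K)/2E(K) \<rightarrow> (K\<^sup>*/(K\<^sup>*)\<^sup>2)\<^sup>2\<close>, as a map on \<open>E(K)\<close>.  It is the
  connecting map of the Kummer sequence followed by the isomorphism of \<open>H\<^sup>1(K, E[2])\<close> with
  \<open>(K\<^sup>*/(K\<^sup>*)\<^sup>2)\<^sup>2\<close>; the component at \<open>e3\<close> is the product of the other two.\<close>

definition descent_map ::
    "('a, 'b) ring_scheme \<Rightarrow> 'a \<Rightarrow> 'a \<Rightarrow> 'a \<Rightarrow> 'a point \<Rightarrow> 'a set \<times> 'a set" where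
  "descent_map K e1 e2 e3 P =
     (descent_component K e1 e2 e3 P, descent_component K e2 e1 e3 P)"

section \<open>The 2-Selmer group over the rationals\<close>

text \<open>The local condition at a completion \<open>K\<close> of the rationals, with embedding \<open>\<iota>\<close>: the class
  of \<open>(b1, b2)\<close> in \<open>(K\<^sup>*/(K\<^sup>*)\<^sup>2)\<^sup>2\<close> comes from \<open>E(K)\<close>.\<close>

definition selmer_local ::
    "('a, 'b) ring_scheme \<Rightarrow> (rat \<Rightarrow> 'a) \<Rightarrow> rat \<Rightarrow> rat \<Rightarrow> rat \<Rightarrow> rat \<Rightarrow> rat \<Rightarrow> bool" where
  "selmer_local K \<iota> e1 e2 e3 b1 b2 \<longleftrightarrow>
     (square_class K (\<iota> b1), square_class K (\<iota> b2))
       \<in> descent_map K (\<iota> e1) (\<iota> e2) (\<iota> e3) ` curve_points K (\<iota> e1) (\<iota> e2) (\<iota> e3)"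

text \<open>\<open>H\<^sup>1(\<rat>, E[2])\<close> is identified with \<open>(\<rat>\<^sup>*/(\<rat>\<^sup>*)\<^sup>2)\<^sup>2\<close> by Kummer theory (\<open>E[2]\<close> is rational);
  the Selmer group consists of the classes that lie in the image of the local descent map at every
  place.  The local conditions do not depend on the representatives \<open>b1\<close>, \<open>b2\<close>.\<close>

definition selmer2 :: "rat \<Rightarrow> rat \<Rightarrow> rat \<Rightarrow> (rat set \<times> rat set) set" where
  "selmer2 e1 e2 e3 =
     {(square_class ring_of_type_algebra b1, square_class ring_of_type_algebra b2) | b1 b2.
        b1 \<noteq> 0 \<and> b2 \<noteq> 0 \<and>
        (\<forall>p. Factorial_Ring.prime p \<longrightarrow> selmer_local (Qp p) (Qp_of_rat p) e1 e2 e3 b1 b2) \<and>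
        selmer_local (ring_of_type_algebra :: real ring) of_rat e1 e2 e3 b1 b2}"

definition selmer2_rank :: "rat \<Rightarrow> rat \<Rightarrow> rat \<Rightarrow> nat" where
  "selmer2_rank e1 e2 e3 = (THE s. card (selmer2 e1 e2 e3) = 2 ^ (2 + s))"

text \<open>\<open>s\<^sup>(\<^sup>2\<^sup>)(E\<^sub>n/\<rat>)\<close> for \<open>E\<^sub>n: y\<^sup>2 = x (x - 1) (x + n\<^sup>2)\<close>.\<close>

definition s2 :: "nat \<Rightarrow> nat" where
  "s2 n = selmer2_rank 0 1 (- (of_nat n)\<^sup>2)"

definition Omega :: "nat \<Rightarrow> nat \<Rightarrow> nat" where
  "Omega k n = card {p \<in> prime_factors n. p mod 8 = k}"

end

(* The Selmer group is determined place by place.  Besides the points over the p-adic numbers that a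
   rational x gives by Hensel's lemma there are the 2-torsion points, and together they hit exactly
   the following classes (b1, b2): same sign at the real place; b1 arbitrary and b2 a square at
   p dividing n with p = 1 mod 4; both of even valuation at p dividing n with p = 3 mod 4; b1 a square
   at q; odd with b1 b2 = 1 mod 4 at 2; both of even valuation at all other primes.  At the good
   primes, where one usually quotes the Hasse bound or the order of E(F_p)/2E(F_p), an elementary
   character sum produces a point over the residue field in every class.  Hence the Selmer group
   consists of the classes of (e P, e c), where e is a sign, P a product of primes p = 1 mod 4
   dividing n, and c is 1 or q: the local conditions on this pair hold automatically, at q by
   quadratic reciprocity. *)

theory Submission
  imports Defs
    "HOL-Computational_Algebra.Nth_Powers"
    "HOL-Number_Theory.Quadratic_Reciprocity"
begin

section \<open>Valuations of rational numbers\<close>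

text \<open>The upper and the lower bound meet because little has to be known about a local point. A
  nonzero rational modulo squares is determined by its sign and the parities of its valuations, so
  the upper bound extracts only these from the local conditions. They leave 2 * 2^t * 2 pairs, where
  t counts the primes p = 1 mod 4 dividing n, and each of them turns out to come from a point at
  every place. The condition modulo 4 has a geometric reason: at an odd p dividing n the cubic
  reduces to x^2 (x - 1), whose node has the tangents y^2 = -x^2, and an odd valuation of b1 forces
  these to be rational over the residue field. The obstacle in the upper bound is that local points
  have classes of Cauchy sequences as coordinates. Absolute values are locally constant away from 0,
  so late terms of the sequences carry the same parities, and the computation takes place with
  rational numbers. The pairs with P = 1 are the classes of the 2-torsion points, which accounts for
  the summand 2 in the exponent 2 + s.\<close>

locale padic =
  fixes p :: nat
  assumes prime_p: "Factorial_Ring.prime p"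
begin

lemma prime_elem_p: "prime_elem (int p)"
  using prime_p by simp

lemma p_gt_1: "real p > 1"
  using prime_gt_1_nat[OF prime_p] by simp

text \<open>The definition reads the valuation off the reduced fraction; cross-multiplication
  carries it over to any other representation.\<close>

lemma val_divide_int:
  assumes "a \<noteq> 0" "b \<noteq> 0"
  shows "padic_val p (of_int a / of_int b)
    = int (multiplicity (int p) a) - int (multiplicity (int p) b)"
proof -
  obtain c d where cd: "quotient_of (of_int a / of_int b) = (c, d)"
    by fastforce
  have d: "d > 0" using quotient_of_denom_pos[OF cd] .
  have eq: "of_int a / of_int b = (of_int c / of_int d :: rat)"
    using quotient_of_div[OF cd] .
  have c: "c \<noteq> 0" using eq assms d by auto
  have "(of_int (a * d) :: rat) = of_int (c * b)"
    using eq assms d by (simp add: field_simps)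
  then have "a * d = c * b" by (simp only: of_int_eq_iff)
  then have "multiplicity (int p) (a * d) = multiplicity (int p) (c * b)" by simp
  then have "multiplicity (int p) a + multiplicity (int p) d
      = multiplicity (int p) c + multiplicity (int p) b"
    using assms c d by (simp add: prime_elem_multiplicity_mult_distrib[OF prime_elem_p])
  then show ?thesis
    by (simp add: padic_val_def cd)
qed

lemma rat_cases_int:
  obtains a b where "(x :: rat) = of_int a / of_int b" "b > 0"
  using quotient_of_div quotient_of_denom_pos by (metis surj_pair)

lemma val_of_int: "padic_val p (of_int k) = int (multiplicity (int p) k)"
  by (simp add: padic_val_def)

lemma val_mult:
  assumes "x \<noteq> 0" "y \<noteq> 0"
  shows "padic_val p (x * y) = padic_val p x + padic_val p y"
proof -
  obtain a b where x: "x = of_int a / of_int b" "b > 0" by (rule rat_cases_int)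
  obtain c d where y: "y = of_int c / of_int d" "d > 0" by (rule rat_cases_int)
  have nz: "a \<noteq> 0" "c \<noteq> 0" "b \<noteq> 0" "d \<noteq> 0" using assms x y by auto
  have "x * y = of_int (a * c) / of_int (b * d)" using x y by simp
  then have "padic_val p (x * y) = int (multiplicity (int p) (a * c)) - int (multiplicity (int p) (b * d))"
    using nz by (metis val_divide_int mult_eq_0_iff)
  then show ?thesis
    using nz x y by (simp add: val_divide_int prime_elem_multiplicity_mult_distrib[OF prime_elem_p])
qed

lemma val_1: "padic_val p 1 = 0"
  using val_of_int[of 1] by simp

lemma val_minus: "padic_val p (- x) = padic_val p x"
proof (cases "x = 0")
  case False
  have "padic_val p (-1) = 0"
    using val_of_int[of "-1"] multiplicity_unit_right[of "-1" "int p"] by simp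
  then show ?thesis using val_mult[of "-1" x] False by simp
qed simp

lemma abs_0 [simp]: "padic_abs p 0 = 0"
  by (simp add: padic_abs_def)

lemma abs_nonneg [simp]: "padic_abs p x \<ge> 0"
  by (simp add: padic_abs_def)

lemma abs_pos: "x \<noteq> 0 \<Longrightarrow> padic_abs p x > 0"
  using p_gt_1 by (simp add: padic_abs_def)

lemma abs_eq_0 [simp]: "padic_abs p x = 0 \<longleftrightarrow> x = 0"
  using abs_pos[of x] by fastforce

lemma abs_mult: "padic_abs p (x * y) = padic_abs p x * padic_abs p y"
  using p_gt_1 by (auto simp: padic_abs_def val_mult power_int_diff power_int_minus field_simps power_int_add)

lemma abs_1 [simp]: "padic_abs p 1 = 1"
  by (simp add: padic_abs_def val_1)

lemma abs_minus [simp]: "padic_abs p (- x) = padic_abs p x"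
  by (simp add: padic_abs_def val_minus)

lemma abs_minus_commute: "padic_abs p (x - y) = padic_abs p (y - x)"
  using abs_minus[of "x - y"] by simp

lemma abs_power: "padic_abs p (x ^ k) = padic_abs p x ^ k"
  by (induction k) (simp_all add: abs_mult)

lemma abs_inverse: "padic_abs p (inverse x) = inverse (padic_abs p x)"
proof (cases "x = 0")
  case False
  then have "padic_abs p (inverse x) * padic_abs p x = 1"
    by (simp flip: abs_mult)
  then show ?thesis using False by (simp add: field_simps)
qed simp

lemma abs_divide: "padic_abs p (x / y) = padic_abs p x / padic_abs p y"
  by (simp add: divide_inverse abs_mult abs_inverse)

lemma abs_less_iff_val:
  assumes "x \<noteq> 0" "y \<noteq> 0"
  shows "padic_abs p x < padic_abs p y \<longleftrightarrow> padic_val p y < padic_val p x"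
  using assms p_gt_1
  by (smt (verit, best) neg_less_iff_less padic_abs_def power_int_strict_increasing)

lemma abs_eq_iff_val:
  assumes "x \<noteq> 0" "y \<noteq> 0"
  shows "padic_abs p x = padic_abs p y \<longleftrightarrow> padic_val p x = padic_val p y"
  using assms abs_less_iff_val[of x y] abs_less_iff_val[of y x] by linarith

lemma abs_le_powi_iff:
  assumes "x \<noteq> 0"
  shows "padic_abs p x \<le> real p powi (- k) \<longleftrightarrow> k \<le> padic_val p x"
  using assms p_gt_1
  by (smt (verit, best) padic_abs_def power_int_increasing power_int_strict_increasing)

lemma abs_of_int_le_iff:
  "padic_abs p (of_int k) \<le> real p powi (- int e) \<longleftrightarrow> int p ^ e dvd k"
proof (cases "k = 0")
  case False
  have "\<not> is_unit (int p)" using prime_elem_p by (rule prime_elem_not_unit)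
  then have "int p ^ e dvd k \<longleftrightarrow> e \<le> multiplicity (int p) k"
    using False by (intro power_dvd_iff_le_multiplicity) auto
  then show ?thesis using False by (simp add: abs_le_powi_iff val_of_int)
qed (simp)

lemma abs_of_int_le_1: "padic_abs p (of_int k) \<le> 1"
  using abs_of_int_le_iff[of k 0] by simp

text \<open>The valuation takes integer values, so no absolute value lies strictly between 1/p and
  1.\<close>

lemma abs_less_1: "padic_abs p x < 1 \<longleftrightarrow> padic_abs p x \<le> inverse (real p)"
proof (cases "x = 0")
  case False
  then show ?thesis using abs_less_iff_val[of x 1] abs_le_powi_iff[of x 1] val_1 by auto
qed (simp)

lemma abs_of_int_less_1_iff: "padic_abs p (of_int k) < 1 \<longleftrightarrow> int p dvd k"
  using abs_of_int_le_iff[of k 1] by (simp add: abs_less_1)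

lemma abs_of_int_eq_1_iff: "padic_abs p (of_int k) = 1 \<longleftrightarrow> \<not> int p dvd k"
  using abs_of_int_less_1_iff[of k] abs_of_int_le_1[of k] by linarith

text \<open>In a reduced fraction p cannot divide both parts, so a denominator divisible by p would
  push the absolute value above 1. This is the passage from p-adically integral rationals to
  congruences of integers.\<close>

lemma abs_le_1_cases:
  assumes "padic_abs p x \<le> 1"
  obtains a b where "x = of_int a / of_int b" "\<not> int p dvd b" "b > 0"
proof -
  obtain a b where ab: "quotient_of x = (a, b)" by fastforce
  have b: "b > 0" and x: "x = of_int a / of_int b" and co: "coprime a b"
    using quotient_of_denom_pos[OF ab] quotient_of_div[OF ab] quotient_of_coprime[OF ab] by auto
  have "\<not> int p dvd b"
  proof
    assume pb: "int p dvd b"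
    have "\<not> int p dvd a"
      using co pb prime_elem_p by (meson coprime_common_divisor prime_elem_not_unit)
    then have "padic_abs p (of_int a) = 1" by (simp add: abs_of_int_eq_1_iff)
    moreover have "padic_abs p (of_int b) < 1" using pb by (simp add: abs_of_int_less_1_iff)
    moreover have "padic_abs p (of_int b) > 0" using b by (intro abs_pos) auto
    ultimately show False using assms by (simp add: x abs_divide)
  qed
  then show thesis using that b x by blast
qed

lemma abs_1_plus_le:
  assumes "padic_abs p x \<le> 1"
  shows "padic_abs p (1 + x) \<le> 1"
proof -
  obtain a b where x: "x = of_int a / of_int b" "\<not> int p dvd b" "b > 0"
    using assms by (rule abs_le_1_cases)
  then have "1 + x = of_int (b + a) / of_int b" by (simp add: field_simps)
  moreover have "padic_abs p (of_int b) = 1" using x by (simp add: abs_of_int_eq_1_iff)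
  ultimately show ?thesis using abs_of_int_le_1[of "b + a"] by (simp only: abs_divide)
qed

text \<open>Division by the larger summand reduces the ultrametric inequality to 1 + y / x with y /
  x integral, where the denominator is a unit.\<close>

lemma abs_add_le_max: "padic_abs p (x + y) \<le> max (padic_abs p x) (padic_abs p y)"
proof -
  have *: "padic_abs p (x + y) \<le> padic_abs p x" if "padic_abs p y \<le> padic_abs p x" for x y
  proof (cases "x = 0")
    case False
    have "padic_abs p (1 + y / x) \<le> 1"
      using that False abs_pos[OF False] by (intro abs_1_plus_le) (simp add: abs_divide)
    then have "padic_abs p x * padic_abs p (1 + y / x) \<le> padic_abs p x"
      by (simp add: mult_left_le)
    then show ?thesis
      using False by (simp flip: abs_mult add: distrib_left)
  qed (use that in simp)
  show ?thesis
    using *[of x y] *[of y x] by (cases "padic_abs p y \<le> padic_abs p x") (auto simp: add.commute)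
qed

lemma abs_diff_le_max: "padic_abs p (x - y) \<le> max (padic_abs p x) (padic_abs p y)"
  using abs_add_le_max[of x "- y"] by simp

lemma abs_add_less: "padic_abs p x < c \<Longrightarrow> padic_abs p y < c \<Longrightarrow> padic_abs p (x + y) < c"
  using abs_add_le_max[of x y] by linarith

lemma abs_add_le: "padic_abs p x \<le> c \<Longrightarrow> padic_abs p y \<le> c \<Longrightarrow> padic_abs p (x + y) \<le> c"
  using abs_add_le_max[of x y] by linarith

lemma abs_diff_le: "padic_abs p x \<le> c \<Longrightarrow> padic_abs p y \<le> c \<Longrightarrow> padic_abs p (x - y) \<le> c"
  using abs_diff_le_max[of x y] by linarith

lemma abs_add_eq:
  assumes "padic_abs p y < padic_abs p x"
  shows "padic_abs p (x + y) = padic_abs p x"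
  using abs_add_le_max[of x y] abs_diff_le_max[of "x + y" y] assms by auto

text \<open>The isosceles principle. It makes the valuation of a nonzero limit equal to that of
  every good enough approximation.\<close>

lemma abs_eq_of_diff_less:
  assumes "padic_abs p (x - y) < padic_abs p x"
  shows "padic_abs p y = padic_abs p x"
  using abs_add_eq[of "y - x" x] assms by (simp add: abs_minus_commute)

section \<open>The p-adic numbers\<close>

lemma null_iff: "f \<in> padic_null p \<longleftrightarrow> (\<forall>\<epsilon>>0. \<exists>N. \<forall>i\<ge>N. padic_abs p (f i) < \<epsilon>)"
  by (simp add: padic_null_def LIMSEQ_iff)

section \<open>Cauchy sequences and null sequences\<close>

lemma cauchyD:
  assumes "f \<in> padic_cauchy p" "\<epsilon> > 0"
  obtains N where "\<And>i j. i \<ge> N \<Longrightarrow> j \<ge> N \<Longrightarrow> padic_abs p (f i - f j) < \<epsilon>"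
  using assms by (fastforce simp: padic_cauchy_def)

lemma nullD:
  assumes "f \<in> padic_null p" "\<epsilon> > 0"
  obtains N where "\<And>i. i \<ge> N \<Longrightarrow> padic_abs p (f i) < \<epsilon>"
  using assms by (fastforce simp: null_iff)

lemma cauchy_bounded:
  assumes f: "f \<in> padic_cauchy p"
  obtains B where "B > 0" "\<And>i. padic_abs p (f i) \<le> B"
proof -
  obtain N where N: "\<And>i j. i \<ge> N \<Longrightarrow> j \<ge> N \<Longrightarrow> padic_abs p (f i - f j) < 1"
    using cauchyD[OF f, of 1] by auto
  define B where "B = 1 + (\<Sum>j\<le>N. padic_abs p (f j))"
  have small: "padic_abs p (f i) \<le> B" if "i \<le> N" for i
    using member_le_sum[of i "{..N}" "\<lambda>j. padic_abs p (f j)"] that by (simp add: B_def)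
  have "padic_abs p (f i) \<le> B" for i
  proof (cases "i \<le> N")
    case False
    then have "padic_abs p (f i - f N) < 1" using N by simp
    moreover have "1 \<le> B" unfolding B_def by (simp add: sum_nonneg)
    ultimately have "padic_abs p (f i - f N) \<le> B" by linarith
    then show ?thesis using abs_add_le[of "f i - f N" B "f N"] small[of N] by simp
  qed (use small in auto)
  moreover have "B > 0" unfolding B_def by (simp add: sum_nonneg add_pos_nonneg)
  ultimately show thesis using that by blast
qed

lemma const_cauchy: "(\<lambda>_. x) \<in> padic_cauchy p"
  by (simp add: padic_cauchy_def)

lemma cauchy_add:
  assumes "f \<in> padic_cauchy p" "g \<in> padic_cauchy p"
  shows "(\<lambda>i. f i + g i) \<in> padic_cauchy p"
  unfolding padic_cauchy_def
proof (intro CollectI allI impI)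
  fix \<epsilon> :: real assume e: "\<epsilon> > 0"
  obtain M where M: "\<And>i j. i \<ge> M \<Longrightarrow> j \<ge> M \<Longrightarrow> padic_abs p (f i - f j) < \<epsilon>"
    using cauchyD[OF assms(1) e] by blast
  obtain N where N: "\<And>i j. i \<ge> N \<Longrightarrow> j \<ge> N \<Longrightarrow> padic_abs p (g i - g j) < \<epsilon>"
    using cauchyD[OF assms(2) e] by blast
  have "padic_abs p (f i + g i - (f j + g j)) < \<epsilon>" if "i \<ge> max M N" "j \<ge> max M N" for i j
    using abs_add_less[OF M[of i j] N[of i j]] that by (simp add: algebra_simps)
  then show "\<exists>N. \<forall>i\<ge>N. \<forall>j\<ge>N. padic_abs p (f i + g i - (f j + g j)) < \<epsilon>" by blast
qed

lemma cauchy_mult: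
  assumes "f \<in> padic_cauchy p" "g \<in> padic_cauchy p"
  shows "(\<lambda>i. f i * g i) \<in> padic_cauchy p"
  unfolding padic_cauchy_def
proof (intro CollectI allI impI)
  fix \<epsilon> :: real assume e: "\<epsilon> > 0"
  obtain B where B: "B > 0" "\<And>i. padic_abs p (f i) \<le> B"
    using cauchy_bounded[OF assms(1)] by blast
  obtain C where C: "C > 0" "\<And>i. padic_abs p (g i) \<le> C"
    using cauchy_bounded[OF assms(2)] by blast
  obtain M where M: "\<And>i j. i \<ge> M \<Longrightarrow> j \<ge> M \<Longrightarrow> padic_abs p (f i - f j) < \<epsilon> / C"
    using cauchyD[OF assms(1), of "\<epsilon> / C"] e C by auto
  obtain N where N: "\<And>i j. i \<ge> N \<Longrightarrow> j \<ge> N \<Longrightarrow> padic_abs p (g i - g j) < \<epsilon> / B"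
    using cauchyD[OF assms(2), of "\<epsilon> / B"] e B by auto
  have "padic_abs p (f i * g i - f j * g j) < \<epsilon>" if "i \<ge> max M N" "j \<ge> max M N" for i j
  proof -
    have "padic_abs p (f i) * padic_abs p (g i - g j) \<le> B * padic_abs p (g i - g j)"
      using B by (intro mult_right_mono) auto
    also have "\<dots> < \<epsilon>" using N[of i j] that B by (simp add: field_simps)
    finally have 1: "padic_abs p (f i * (g i - g j)) < \<epsilon>" by (simp add: abs_mult)
    have "padic_abs p (g j) * padic_abs p (f i - f j) \<le> C * padic_abs p (f i - f j)"
      using C by (intro mult_right_mono) auto
    also have "\<dots> < \<epsilon>" using M[of i j] that C by (simp add: field_simps)
    finally have 2: "padic_abs p (g j * (f i - f j)) < \<epsilon>" by (simp add: abs_mult)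
    show ?thesis using abs_add_less[OF 1 2] by (simp add: algebra_simps)
  qed
  then show "\<exists>N. \<forall>i\<ge>N. \<forall>j\<ge>N. padic_abs p (f i * g i - f j * g j) < \<epsilon>" by blast
qed

lemma cauchy_uminus: "f \<in> padic_cauchy p \<Longrightarrow> (\<lambda>i. - f i) \<in> padic_cauchy p"
  using cauchy_mult[OF const_cauchy[of "-1"]] by simp

lemma cauchy_diff:
  "f \<in> padic_cauchy p \<Longrightarrow> g \<in> padic_cauchy p \<Longrightarrow> (\<lambda>i. f i - g i) \<in> padic_cauchy p"
  using cauchy_add[OF _ cauchy_uminus, of f g] by simp

lemma null_cauchy:
  assumes f: "f \<in> padic_null p"
  shows "f \<in> padic_cauchy p"
  unfolding padic_cauchy_def
proof (intro CollectI allI impI)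
  fix \<epsilon> :: real assume e: "\<epsilon> > 0"
  obtain N where N: "\<And>i. i \<ge> N \<Longrightarrow> padic_abs p (f i) < \<epsilon>"
    using nullD[OF f e] by blast
  have "padic_abs p (f i - f j) < \<epsilon>" if "i \<ge> N" "j \<ge> N" for i j
    using abs_add_less[of "f i" \<epsilon> "- f j"] N that by simp
  then show "\<exists>N. \<forall>i\<ge>N. \<forall>j\<ge>N. padic_abs p (f i - f j) < \<epsilon>" by blast
qed

lemma null_zero: "(\<lambda>_. 0) \<in> padic_null p"
  by (simp add: padic_null_def)

lemma null_add:
  assumes "f \<in> padic_null p" "g \<in> padic_null p"
  shows "(\<lambda>i. f i + g i) \<in> padic_null p"
  unfolding null_iff
proof (intro allI impI)
  fix \<epsilon> :: real assume e: "\<epsilon> > 0"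
  obtain M where M: "\<And>i. i \<ge> M \<Longrightarrow> padic_abs p (f i) < \<epsilon>" using nullD[OF assms(1) e] by blast
  obtain N where N: "\<And>i. i \<ge> N \<Longrightarrow> padic_abs p (g i) < \<epsilon>" using nullD[OF assms(2) e] by blast
  have "padic_abs p (f i + g i) < \<epsilon>" if "i \<ge> max M N" for i
    using abs_add_less[OF M N] that by simp
  then show "\<exists>N. \<forall>i\<ge>N. padic_abs p (f i + g i) < \<epsilon>" by blast
qed

lemma null_mult:
  assumes "f \<in> padic_null p" "g \<in> padic_cauchy p"
  shows "(\<lambda>i. g i * f i) \<in> padic_null p"
  unfolding null_iff
proof (intro allI impI)
  fix \<epsilon> :: real assume e: "\<epsilon> > 0"
  obtain B where B: "B > 0" "\<And>i. padic_abs p (g i) \<le> B"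
    using cauchy_bounded[OF assms(2)] by blast
  obtain N where N: "\<And>i. i \<ge> N \<Longrightarrow> padic_abs p (f i) < \<epsilon> / B"
    using nullD[OF assms(1), of "\<epsilon> / B"] e B by auto
  have "padic_abs p (g i * f i) < \<epsilon>" if "i \<ge> N" for i
  proof -
    have "padic_abs p (g i) * padic_abs p (f i) \<le> B * padic_abs p (f i)"
      using B by (intro mult_right_mono) auto
    also have "\<dots> < \<epsilon>" using N[of i] that B by (simp add: field_simps)
    finally show ?thesis by (simp add: abs_mult)
  qed
  then show "\<exists>N. \<forall>i\<ge>N. padic_abs p (g i * f i) < \<epsilon>" by blast
qed

lemma null_uminus: "f \<in> padic_null p \<Longrightarrow> (\<lambda>i. - f i) \<in> padic_null p"
  using null_mult[OF _ const_cauchy[of "-1"]] by simp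

lemma const_null_iff: "(\<lambda>_. x) \<in> padic_null p \<longleftrightarrow> x = 0"
  by (simp add: padic_null_def LIMSEQ_const_iff)

text \<open>Some late term has absolute value at least \<open>e\<close>, while the tail varies by
  less than \<open>e\<close>; by the isosceles principle the whole tail then has the absolute value
  of that term.\<close>

lemma cauchy_not_null_bounded_below:
  assumes f: "f \<in> padic_cauchy p" and nn: "f \<notin> padic_null p"
  obtains c N where "c > 0" "\<And>i. i \<ge> N \<Longrightarrow> padic_abs p (f i) \<ge> c"
proof -
  obtain e where e: "e > 0" "\<And>N. \<exists>i\<ge>N. padic_abs p (f i) \<ge> e"
    using nn by (force simp: null_iff not_less)
  obtain N where N: "\<And>i j. i \<ge> N \<Longrightarrow> j \<ge> N \<Longrightarrow> padic_abs p (f i - f j) < e"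
    using cauchyD[OF f e(1)] by blast
  obtain k where k: "k \<ge> N" "padic_abs p (f k) \<ge> e" using e by blast
  have "padic_abs p (f i) \<ge> e" if "i \<ge> N" for i
    using abs_eq_of_diff_less[of "f k" "f i"] N[of k i] k that by simp
  then show thesis using that e by blast
qed

section \<open>The completion as a quotient ring\<close>

lemma cauchy_ring_simps:
  "carrier (padic_cauchy_ring p) = padic_cauchy p"
  "f \<otimes>\<^bsub>padic_cauchy_ring p\<^esub> g = (\<lambda>i. f i * g i)"
  "f \<oplus>\<^bsub>padic_cauchy_ring p\<^esub> g = (\<lambda>i. f i + g i)"
  "\<one>\<^bsub>padic_cauchy_ring p\<^esub> = (\<lambda>i. 1)"
  "\<zero>\<^bsub>padic_cauchy_ring p\<^esub> = (\<lambda>i. 0)"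
  by (simp_all add: padic_cauchy_ring_def)

lemma cring_cauchy_ring: "cring (padic_cauchy_ring p)"
proof (rule cringI)
  show "abelian_group (padic_cauchy_ring p)"
  proof (rule abelian_groupI)
    fix f assume "f \<in> carrier (padic_cauchy_ring p)"
    then show "\<exists>g\<in>carrier (padic_cauchy_ring p).
        g \<oplus>\<^bsub>padic_cauchy_ring p\<^esub> f = \<zero>\<^bsub>padic_cauchy_ring p\<^esub>"
      by (auto simp: cauchy_ring_simps fun_eq_iff intro!: bexI[OF _ cauchy_uminus])
  qed (auto simp: cauchy_ring_simps algebra_simps cauchy_add const_cauchy)
  show "Group.comm_monoid (padic_cauchy_ring p)"
    by (rule comm_monoidI) (auto simp: cauchy_ring_simps algebra_simps cauchy_mult const_cauchy)
qed (auto simp: cauchy_ring_simps algebra_simps)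

lemma a_inv_cauchy_ring:
  assumes "f \<in> padic_cauchy p"
  shows "\<ominus>\<^bsub>padic_cauchy_ring p\<^esub> f = (\<lambda>i. - f i)"
proof -
  interpret R: cring "padic_cauchy_ring p" by (rule cring_cauchy_ring)
  show ?thesis
    by (rule R.minus_equality) (use assms cauchy_uminus in \<open>auto simp: cauchy_ring_simps\<close>)
qed

lemma ideal_null: "ideal (padic_null p) (padic_cauchy_ring p)"
proof -
  interpret R: cring "padic_cauchy_ring p" by (rule cring_cauchy_ring)
  show ?thesis
  proof (rule idealI)
    show "subgroup (padic_null p) (add_monoid (padic_cauchy_ring p))"
    proof (rule R.add.subgroupI)
      fix f assume "f \<in> padic_null p"
      then show "\<ominus>\<^bsub>padic_cauchy_ring p\<^esub> f \<in> padic_null p"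
        by (simp add: a_inv_cauchy_ring null_cauchy null_uminus)
    qed (use null_zero in \<open>auto simp: cauchy_ring_simps null_cauchy null_add\<close>)
  next
    fix f g assume "f \<in> padic_null p" "g \<in> carrier (padic_cauchy_ring p)"
    then show "g \<otimes>\<^bsub>padic_cauchy_ring p\<^esub> f \<in> padic_null p"
      by (simp add: cauchy_ring_simps null_mult)
  next
    fix f g assume "f \<in> padic_null p" "g \<in> carrier (padic_cauchy_ring p)"
    then show "f \<otimes>\<^bsub>padic_cauchy_ring p\<^esub> g \<in> padic_null p"
      using null_mult[of f g] by (simp add: cauchy_ring_simps mult.commute)
  qed (rule R.ring_axioms)
qed

abbreviation cls :: "(nat \<Rightarrow> rat) \<Rightarrow> (nat \<Rightarrow> rat) set" where
  "cls f \<equiv> padic_null p +>\<^bsub>padic_cauchy_ring p\<^esub> f"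

sublocale Q: cring "Qp p"
  unfolding Qp_def by (rule ideal.quotient_is_cring[OF ideal_null cring_cauchy_ring])

lemma Qp_carrier: "carrier (Qp p) = cls ` padic_cauchy p"
  by (auto simp: Qp_def FactRing_def A_RCOSETS_def RCOSETS_def a_r_coset_def cauchy_ring_simps)

lemma cls_carrier: "f \<in> padic_cauchy p \<Longrightarrow> cls f \<in> carrier (Qp p)"
  by (simp add: Qp_carrier)

lemma cls_mult:
  assumes "f \<in> padic_cauchy p" "g \<in> padic_cauchy p"
  shows "cls f \<otimes>\<^bsub>Qp p\<^esub> cls g = cls (\<lambda>i. f i * g i)"
  using ideal.rcoset_mult_add[OF ideal_null, of f g] assms
  by (simp add: Qp_def FactRing_def cauchy_ring_simps)

lemma cls_add:
  assumes "f \<in> padic_cauchy p" "g \<in> padic_cauchy p"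
  shows "cls f \<oplus>\<^bsub>Qp p\<^esub> cls g = cls (\<lambda>i. f i + g i)"
  using ring_hom_add[OF ideal.rcos_ring_hom[OF ideal_null], of f g] assms
  by (simp add: Qp_def cauchy_ring_simps)

lemma cls_one: "\<one>\<^bsub>Qp p\<^esub> = cls (\<lambda>_. 1)"
  by (simp add: Qp_def FactRing_def cauchy_ring_simps)

lemma cls_eq_iff:
  assumes "f \<in> padic_cauchy p" "g \<in> padic_cauchy p"
  shows "cls f = cls g \<longleftrightarrow> (\<lambda>i. f i - g i) \<in> padic_null p"
proof -
  interpret I: ideal "padic_null p" "padic_cauchy_ring p" by (rule ideal_null)
  have "cls f = cls g \<longleftrightarrow> f \<ominus>\<^bsub>padic_cauchy_ring p\<^esub> g \<in> padic_null p"
    using I.quotient_eq_iff_same_a_r_cos[OF ideal_null, of f g] assms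
    by (simp add: cauchy_ring_simps)
  also have "f \<ominus>\<^bsub>padic_cauchy_ring p\<^esub> g = (\<lambda>i. f i - g i)"
    using assms by (simp add: a_minus_def a_inv_cauchy_ring cauchy_ring_simps)
  finally show ?thesis .
qed

text \<open>The zero of the quotient is the ideal itself; the coset of the zero sequence is
  recognised as zero because it is idempotent under addition.\<close>

lemma cls_zero: "\<zero>\<^bsub>Qp p\<^esub> = cls (\<lambda>_. 0)"
proof -
  have "cls (\<lambda>_. 0) \<oplus>\<^bsub>Qp p\<^esub> cls (\<lambda>_. 0) = cls (\<lambda>_. 0)"
    by (simp add: cls_add const_cauchy)
  then show ?thesis
    using Q.add.r_cancel_one'[of "cls (\<lambda>_. 0)" "cls (\<lambda>_. 0)"] cls_carrier[OF const_cauchy]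
    by fastforce
qed

lemma cls_minus:
  assumes "f \<in> padic_cauchy p" "g \<in> padic_cauchy p"
  shows "cls f \<ominus>\<^bsub>Qp p\<^esub> cls g = cls (\<lambda>i. f i - g i)"
proof -
  have "\<ominus>\<^bsub>Qp p\<^esub> cls g = cls (\<lambda>i. - g i)"
    by (rule Q.minus_equality) (use assms in \<open>auto simp: cls_add cls_zero cauchy_uminus cls_carrier\<close>)
  then show ?thesis using assms by (simp add: a_minus_def cls_add cauchy_uminus)
qed

lemma of_rat_carrier [simp]: "Qp_of_rat p a \<in> carrier (Qp p)"
  by (simp add: Qp_of_rat_def cls_carrier const_cauchy)

lemma of_rat_mult: "Qp_of_rat p (a * b) = Qp_of_rat p a \<otimes>\<^bsub>Qp p\<^esub> Qp_of_rat p b"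
  by (simp add: Qp_of_rat_def cls_mult const_cauchy)

lemma of_rat_diff: "Qp_of_rat p (a - b) = Qp_of_rat p a \<ominus>\<^bsub>Qp p\<^esub> Qp_of_rat p b"
  by (simp add: Qp_of_rat_def cls_minus const_cauchy)

lemma of_rat_one: "Qp_of_rat p 1 = \<one>\<^bsub>Qp p\<^esub>"
  by (simp add: Qp_of_rat_def cls_one)

lemma of_rat_zero: "Qp_of_rat p 0 = \<zero>\<^bsub>Qp p\<^esub>"
  by (simp add: Qp_of_rat_def cls_zero)

lemma of_rat_eq_iff [simp]: "Qp_of_rat p a = Qp_of_rat p b \<longleftrightarrow> a = b"
  by (simp add: Qp_of_rat_def cls_eq_iff const_cauchy const_null_iff)

lemma of_rat_Units:
  assumes "a \<noteq> 0"
  shows "Qp_of_rat p a \<in> Units (Qp p)"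
proof -
  have "Qp_of_rat p a \<otimes>\<^bsub>Qp p\<^esub> Qp_of_rat p (inverse a) = \<one>\<^bsub>Qp p\<^esub>"
    using assms by (simp flip: of_rat_mult of_rat_one)
  then show ?thesis
    using Q.Units_one_closed Q.unit_factor[of "Qp_of_rat p a" "Qp_of_rat p (inverse a)"] by simp
qed

end

section \<open>Square classes\<close>

lemma (in cring) unit_squares_simps:
  "square_class R a = {u \<otimes> u \<otimes> a | u. u \<in> Units R}"
  by (auto simp: square_class_def unit_squares_def r_coset_def units_of_mult)

lemma (in cring) square_class_eqD:
  assumes "a \<in> carrier R" "square_class R a = square_class R c"
  obtains u where "u \<in> Units R" "a = u \<otimes> u \<otimes> c"
proof -
  have "a \<in> square_class R a"
    using assms(1) by (auto simp: unit_squares_simps intro!: exI[of _ \<one>])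
  then show thesis using assms(2) that by (auto simp: unit_squares_simps)
qed

lemma (in cring) square_class_eqI:
  assumes "u \<in> Units R" "c \<in> carrier R"
  shows "square_class R (u \<otimes> u \<otimes> c) = square_class R c"
proof (intro equalityI subsetI)
  fix z assume "z \<in> square_class R (u \<otimes> u \<otimes> c)"
  then obtain w where w: "w \<in> Units R" "z = w \<otimes> w \<otimes> (u \<otimes> u \<otimes> c)"
    by (auto simp: unit_squares_simps)
  then have "z = (w \<otimes> u) \<otimes> (w \<otimes> u) \<otimes> c"
    using assms by (simp add: m_ac Units_closed)
  then show "z \<in> square_class R c"
    using w assms by (auto simp: unit_squares_simps)
next
  fix z assume "z \<in> square_class R c"
  then obtain w where w: "w \<in> Units R" "z = w \<otimes> w \<otimes> c"
    by (auto simp: unit_squares_simps)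
  have "(w \<otimes> inv u) \<otimes> (w \<otimes> inv u) \<otimes> (u \<otimes> u \<otimes> c)
      = w \<otimes> w \<otimes> (inv u \<otimes> u) \<otimes> (inv u \<otimes> u) \<otimes> c"
    using assms w by (simp add: m_ac Units_closed)
  also have "\<dots> = z" using w assms by (simp add: Units_closed)
  finally show "z \<in> square_class R (u \<otimes> u \<otimes> c)"
    using w assms by (auto simp: unit_squares_simps intro!: exI[of _ "w \<otimes> inv u"])
qed

section \<open>Hensel's lemma for square roots of rational numbers\<close>

context padic
begin

text \<open>A predicate on rationals, because every point constructed below has a rational abscissa
  and only its ordinate lies in the completion. The value 0 is excluded so that the root is a unit
  and defines a square class.\<close>

definition padic_square :: "rat \<Rightarrow> bool" where
  "padic_square a \<longleftrightarrow> a \<noteq> 0 \<and> (\<exists>s\<in>carrier (Qp p). s \<otimes>\<^bsub>Qp p\<^esub> s = Qp_of_rat p a)"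

lemma padic_square_nz: "padic_square a \<Longrightarrow> a \<noteq> 0"
  by (simp add: padic_square_def)

lemma padic_square_power2: "c \<noteq> 0 \<Longrightarrow> padic_square (c ^ 2)"
  by (auto simp: padic_square_def power2_eq_square of_rat_mult)

lemma padic_square_mult:
  assumes "padic_square a" "padic_square b"
  shows "padic_square (a * b)"
proof -
  obtain s t where s: "s \<in> carrier (Qp p)" "s \<otimes>\<^bsub>Qp p\<^esub> s = Qp_of_rat p a"
    and t: "t \<in> carrier (Qp p)" "t \<otimes>\<^bsub>Qp p\<^esub> t = Qp_of_rat p b"
    using assms by (auto simp: padic_square_def)
  have "(s \<otimes>\<^bsub>Qp p\<^esub> t) \<otimes>\<^bsub>Qp p\<^esub> (s \<otimes>\<^bsub>Qp p\<^esub> t) = (s \<otimes>\<^bsub>Qp p\<^esub> s) \<otimes>\<^bsub>Qp p\<^esub> (t \<otimes>\<^bsub>Qp p\<^esub> t)"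
    using s(1) t(1) by (simp add: Q.m_ac)
  also have "\<dots> = Qp_of_rat p (a * b)" by (simp only: s(2) t(2) of_rat_mult)
  finally show ?thesis using s t assms by (auto simp: padic_square_def)
qed

text \<open>The numbers \<open>a\<close> and \<open>b\<close> differ by the square of
  \<open>d / c\<close>; the relation is cleared of denominators so that it becomes a polynomial
  identity in the applications.\<close>

lemma padic_square_cong:
  assumes "padic_square a" "c \<noteq> 0" "a * d ^ 2 = b * c ^ 2" "d \<noteq> 0"
  shows "padic_square b"
proof -
  have "padic_square (a * (d / c) ^ 2)" using assms by (intro padic_square_mult padic_square_power2) auto
  moreover have "a * (d / c) ^ 2 = b" using assms by (simp add: field_simps)
  ultimately show ?thesis by simp
qed

text \<open>Newton's iteration for the equation s^2 = t with starting value 1. Its iterates are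
  rational, so the sequence itself represents the root in the completion.\<close>

primrec newton_sqrt :: "rat \<Rightarrow> nat \<Rightarrow> rat" where
  "newton_sqrt t 0 = 1"
| "newton_sqrt t (Suc i) = newton_sqrt t i + (t - newton_sqrt t i ^ 2) / (2 * newton_sqrt t i)"

text \<open>A Newton step s + d leaves the error (s + d)^2 - t = d^2, and d is the old error divided
  by 2s. Measured relative to the absolute value of 4, the error is therefore squared at each step;
  of this quadratic rate only the geometric decay with ratio \<open>\<rho>\<close> is kept. The
  normalisation by 4 treats p = 2 and odd p at once.\<close>

lemma newton_sqrt_invariant:
  fixes t :: rat
  defines "\<rho> \<equiv> padic_abs p (t - 1) / padic_abs p 4"
  assumes \<rho>: "\<rho> < 1"
  shows "padic_abs p (newton_sqrt t i) = 1"
    and "padic_abs p (newton_sqrt t i ^ 2 - t) \<le> padic_abs p 4 * \<rho> ^ Suc i"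
    and "padic_abs p (newton_sqrt t (Suc i) - newton_sqrt t i) \<le> \<rho> ^ Suc i"
proof -
  have N4: "padic_abs p 4 = padic_abs p 2 ^ 2"
    using abs_power[of 2 2] by simp
  have N2: "padic_abs p 2 > 0" "padic_abs p 2 \<le> 1"
    using abs_pos[of 2] abs_of_int_le_1[of 2] by auto
  have \<rho>0: "\<rho> \<ge> 0" unfolding \<rho>_def by simp
  have step: "padic_abs p ((t - s ^ 2) / (2 * s)) \<le> padic_abs p 2 * \<rho> ^ Suc i"
    if "padic_abs p s = 1" "padic_abs p (s ^ 2 - t) \<le> padic_abs p 4 * \<rho> ^ Suc i" for s i
    using that N2 abs_minus_commute[of t "s ^ 2"]
    by (simp add: abs_divide abs_mult N4 power2_eq_square field_simps)
  have main: "padic_abs p (newton_sqrt t i) = 1 \<and>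
      padic_abs p (newton_sqrt t i ^ 2 - t) \<le> padic_abs p 4 * \<rho> ^ Suc i" for i
  proof (induction i)
    case 0
    then show ?case using N2 abs_minus_commute[of 1 t] abs_pos[of 4] by (simp add: \<rho>_def)
  next
    case (Suc i)
    define s where "s = newton_sqrt t i"
    define d where "d = (t - s ^ 2) / (2 * s)"
    have s: "padic_abs p s = 1" and e: "padic_abs p (s ^ 2 - t) \<le> padic_abs p 4 * \<rho> ^ Suc i"
      using Suc unfolding s_def by auto
    have s0: "s \<noteq> 0" using s by auto
    have d: "padic_abs p d \<le> padic_abs p 2 * \<rho> ^ Suc i"
      unfolding d_def by (rule step[OF s e])
    have r2: "\<rho> ^ Suc i \<le> \<rho>"
      using mult_left_le[of "\<rho> ^ i" \<rho>] \<rho> \<rho>0 by (simp add: power_le_one)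
    then have r1: "\<rho> ^ Suc i < 1" using \<rho> by linarith
    have "padic_abs p 2 * \<rho> ^ Suc i \<le> 1 * \<rho> ^ Suc i"
      using N2 \<rho>0 by (intro mult_right_mono) auto
    then have "padic_abs p d < 1" using d r1 by linarith
    then have 1: "padic_abs p (s + d) = 1" using abs_add_eq[of d s] s by simp
    have sd: "2 * s * d = t - s ^ 2" using s0 by (simp add: d_def)
    have "(s + d) ^ 2 - t = s ^ 2 + 2 * s * d + d ^ 2 - t" by (simp add: power2_eq_square algebra_simps)
    then have "(s + d) ^ 2 - t = d ^ 2" by (simp add: sd)
    then have "padic_abs p ((s + d) ^ 2 - t) = padic_abs p d ^ 2" by (simp add: abs_power)
    also have "\<dots> \<le> (padic_abs p 2 * \<rho> ^ Suc i) ^ 2"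
      using d by (intro power_mono) auto
    also have "\<dots> = padic_abs p 4 * (\<rho> ^ Suc i * \<rho> ^ Suc i)"
      by (simp add: N4 power2_eq_square algebra_simps)
    also have "\<dots> \<le> padic_abs p 4 * (\<rho> ^ Suc i * \<rho>)"
      using r2 \<rho>0 by (intro mult_left_mono) auto
    also have "\<dots> = padic_abs p 4 * \<rho> ^ Suc (Suc i)" by simp
    finally show ?case using 1 by (simp add: s_def d_def)
  qed
  show "padic_abs p (newton_sqrt t i) = 1"
    and "padic_abs p (newton_sqrt t i ^ 2 - t) \<le> padic_abs p 4 * \<rho> ^ Suc i"
    using main by auto
  have "padic_abs p (newton_sqrt t (Suc i) - newton_sqrt t i) \<le> padic_abs p 2 * \<rho> ^ Suc i"
    using step main[of i] by simp
  also have "\<dots> \<le> 1 * \<rho> ^ Suc i" using N2 \<rho>0 by (intro mult_right_mono) auto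
  finally show "padic_abs p (newton_sqrt t (Suc i) - newton_sqrt t i) \<le> \<rho> ^ Suc i" by simp
qed

text \<open>The Newton iterates form a Cauchy sequence whose squares tend to \<open>t\<close>. For
  odd p the bound says t = 1 mod p, for p = 2 it says t = 1 mod 8.\<close>

lemma padic_square_near_1:
  assumes t: "padic_abs p (t - 1) < padic_abs p 4"
  shows "padic_square t"
proof -
  define \<rho> where "\<rho> = padic_abs p (t - 1) / padic_abs p 4"
  have N4: "padic_abs p 4 > 0" "padic_abs p 4 \<le> 1"
    using abs_pos[of 4] abs_of_int_le_1[of 4] by auto
  have \<rho>: "\<rho> < 1" "\<rho> \<ge> 0" using t N4 by (auto simp: \<rho>_def field_simps)
  let ?s = "newton_sqrt t"
  note inv = newton_sqrt_invariant[of t, folded \<rho>_def, OF \<rho>(1)]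
  have diff: "padic_abs p (?s (i + k) - ?s i) \<le> \<rho> ^ i" for i k
  proof (induction k)
    case (Suc k)
    have "\<rho> ^ Suc (i + k) \<le> \<rho> ^ i" using \<rho> by (intro power_decreasing) auto
    then have "padic_abs p (?s (Suc (i + k)) - ?s (i + k)) \<le> \<rho> ^ i"
      using inv(3)[of "i + k"] by linarith
    from abs_add_le[OF this Suc] show ?case by (simp del: newton_sqrt.simps)
  qed (use \<rho> in simp)
  have lim: "(\<lambda>i. \<rho> ^ i) \<longlonglongrightarrow> 0" using \<rho> by (intro LIMSEQ_power_zero) simp
  have "?s \<in> padic_cauchy p"
    unfolding padic_cauchy_def
  proof (intro CollectI allI impI)
    fix \<epsilon> :: real assume "\<epsilon> > 0"
    then obtain N where N: "\<And>i. i \<ge> N \<Longrightarrow> \<rho> ^ i < \<epsilon>"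
      using lim \<rho> by (force simp: LIMSEQ_iff)
    have "padic_abs p (?s i - ?s j) < \<epsilon>" if "i \<ge> N" "j \<ge> N" for i j
    proof -
      have "padic_abs p (?s i - ?s N) < \<epsilon>" "padic_abs p (?s N - ?s j) < \<epsilon>"
        using diff[of N "i - N"] diff[of N "j - N"] that N[of N] abs_minus_commute[of "?s N" "?s j"]
        by auto
      then show ?thesis using abs_add_less[of "?s i - ?s N" \<epsilon> "?s N - ?s j"] by simp
    qed
    then show "\<exists>N. \<forall>i\<ge>N. \<forall>j\<ge>N. padic_abs p (?s i - ?s j) < \<epsilon>" by blast
  qed
  moreover have "(\<lambda>i. ?s i * ?s i - t) \<in> padic_null p"
    unfolding padic_null_def
  proof (intro CollectI tendsto_sandwich[OF _ _ tendsto_const LIMSEQ_Suc[OF lim]] always_eventually allI)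
    fix i
    have "padic_abs p 4 * \<rho> ^ Suc i \<le> 1 * \<rho> ^ Suc i" using N4 \<rho> by (intro mult_right_mono) auto
    then show "padic_abs p (?s i * ?s i - t) \<le> \<rho> ^ Suc i"
      using inv(2)[of i] by (simp add: power2_eq_square)
  qed simp
  ultimately have "cls ?s \<in> carrier (Qp p)" "cls ?s \<otimes>\<^bsub>Qp p\<^esub> cls ?s = Qp_of_rat p t"
    by (simp_all add: cls_carrier cls_mult Qp_of_rat_def cls_eq_iff cauchy_mult const_cauchy)
  moreover have "t \<noteq> 0" using t N4 abs_minus[of 1] by auto
  ultimately show ?thesis by (auto simp: padic_square_def)
qed

lemma padic_square_of_int_cong:
  assumes "\<not> int p dvd a" "\<not> int p dvd s" "padic_abs p (of_int (a - s ^ 2)) < padic_abs p 4"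
  shows "padic_square (of_int a)"
proof -
  have s: "padic_abs p (of_int s) = 1" "s \<noteq> 0" using assms(2) by (auto simp: abs_of_int_eq_1_iff)
  have "of_int a / of_int s ^ 2 - 1 = (of_int (a - s ^ 2) / of_int s ^ 2 :: rat)"
    using s by (simp add: field_simps)
  then have "padic_abs p (of_int a / of_int s ^ 2 - 1) < padic_abs p 4"
    using assms(3) s by (simp only: abs_divide abs_power) simp
  then have "padic_square (of_int a / of_int s ^ 2)" by (rule padic_square_near_1)
  then show ?thesis
    by (rule padic_square_cong[where c = 1 and d = "of_int s"]) (use s in auto)
qed

lemma padic_square_residue:
  assumes "odd p" "\<not> int p dvd a" "QuadRes (int p) a"
  shows "padic_square (of_int a)"
proof -
  obtain s where s: "[s ^ 2 = a] (mod int p)" using assms(3) by (auto simp: QuadRes_def)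
  then have dvd: "int p dvd a - s ^ 2" by (simp add: cong_iff_dvd_diff dvd_diff_commute)
  have "int p dvd (a - s ^ 2) + s ^ 2" if "int p dvd s"
    using dvd that by (intro dvd_add) (auto simp: power2_eq_square)
  then have "\<not> int p dvd s" using assms(2) by auto
  moreover have "\<not> int p dvd 4"
  proof
    assume "int p dvd 4"
    then have "int p dvd 2 ^ 2" by simp
    then have "int p dvd 2" using prime_elem_p prime_elem_dvd_power by blast
    then have "int p \<le> 2" by (rule zdvd_imp_le) simp
    then show False using assms(1) prime_gt_1_nat[OF prime_p] by (cases "p = 2") auto
  qed
  then have "padic_abs p 4 = 1" using abs_of_int_eq_1_iff[of 4] by simp
  ultimately show ?thesis
    using assms(2) dvd abs_of_int_less_1_iff[of "a - s ^ 2"]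
    by (intro padic_square_of_int_cong[of a s]) simp_all
qed

text \<open>At 2 an absolute value strictly below that of 4 is at most 2^-3, hence the modulus
  8.\<close>

lemma padic_square_2adic:
  assumes "p = 2" "a mod 8 = 1"
  shows "padic_square (of_int a)"
proof (rule padic_square_of_int_cong[of a 1])
  have "8 dvd a - 1" using assms(2) by presburger
  then have "padic_abs p (of_int (a - 1)) \<le> real p powi (- int 3)"
    unfolding abs_of_int_le_iff by (simp add: assms(1))
  moreover have "\<not> padic_abs p (of_int 4) \<le> real p powi (- int 3)"
    unfolding abs_of_int_le_iff by (simp add: assms(1))
  ultimately show "padic_abs p (of_int (a - 1 ^ 2)) < padic_abs p 4" by simp
  have "odd a" using assms(2) by presburger
  then show "\<not> int p dvd a" by (simp add: assms(1))
qed (simp add: assms(1))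

text \<open>If s^2 = a b, then the square of the unit s / b carries b to a.\<close>

lemma square_class_eq_of_is_square:
  assumes "padic_square (a * b)"
  shows "square_class (Qp p) (Qp_of_rat p a) = square_class (Qp p) (Qp_of_rat p b)"
proof -
  have ab: "a \<noteq> 0" "b \<noteq> 0" using padic_square_nz[OF assms] by auto
  obtain s where s: "s \<in> carrier (Qp p)" "s \<otimes>\<^bsub>Qp p\<^esub> s = Qp_of_rat p (a * b)"
    using assms by (auto simp: padic_square_def)
  define r where "r = Qp_of_rat p (inverse b)"
  have r: "r \<in> Units (Qp p)" using ab by (simp add: r_def of_rat_Units)
  have rc: "r \<in> carrier (Qp p)" by (simp add: r_def)
  have su: "s \<in> Units (Qp p)"
    using Q.unit_factor[of s s] s of_rat_Units[of "a * b"] ab by simp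
  have "(s \<otimes>\<^bsub>Qp p\<^esub> r) \<otimes>\<^bsub>Qp p\<^esub> (s \<otimes>\<^bsub>Qp p\<^esub> r) \<otimes>\<^bsub>Qp p\<^esub> Qp_of_rat p b
      = (s \<otimes>\<^bsub>Qp p\<^esub> s) \<otimes>\<^bsub>Qp p\<^esub> (r \<otimes>\<^bsub>Qp p\<^esub> r \<otimes>\<^bsub>Qp p\<^esub> Qp_of_rat p b)"
    using s rc by (simp add: Q.m_ac)
  also have "\<dots> = Qp_of_rat p (a * b * (inverse b * inverse b * b))"
    using s by (simp add: r_def of_rat_mult)
  also have "\<dots> = Qp_of_rat p a" using ab by simp
  finally show ?thesis
    using Q.square_class_eqI[of "s \<otimes>\<^bsub>Qp p\<^esub> r" "Qp_of_rat p b"] su r by simp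
qed

text \<open>Equal classes mean b = U^2 F in the completion. Once sequences representing U and F make
  the error smaller than b itself, the isosceles principle gives an exact equality of absolute
  values between rationals, and the square contributes an even valuation.\<close>

lemma square_class_eq_valuation:
  assumes f: "f \<in> padic_cauchy p" and b: "b \<noteq> 0"
    and eq: "square_class (Qp p) (Qp_of_rat p b) = square_class (Qp p) (cls f)"
  shows "\<forall>\<^sub>F i in sequentially. f i \<noteq> 0 \<and> even (padic_val p b + padic_val p (f i))"
proof -
  obtain U where U: "U \<in> Units (Qp p)"
    "Qp_of_rat p b = U \<otimes>\<^bsub>Qp p\<^esub> U \<otimes>\<^bsub>Qp p\<^esub> cls f"
    using Q.square_class_eqD[OF _ eq] by auto
  obtain u where u: "u \<in> padic_cauchy p" "U = cls u"
    using Q.Units_closed[OF U(1)] by (auto simp: Qp_carrier)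
  have "cls (\<lambda>_. b) = cls (\<lambda>i. u i * u i * f i)"
    using U(2) u f by (simp add: Qp_of_rat_def cls_mult cauchy_mult)
  then have "(\<lambda>i. b - u i * u i * f i) \<in> padic_null p"
    using u(1) f by (simp add: cls_eq_iff cauchy_mult const_cauchy)
  from nullD[OF this abs_pos[OF b]]
  obtain N where N: "\<And>i. i \<ge> N \<Longrightarrow> padic_abs p (b - u i * u i * f i) < padic_abs p b"
    by blast
  have "f i \<noteq> 0 \<and> even (padic_val p b + padic_val p (f i))" if "i \<ge> N" for i
  proof -
    have eq: "padic_abs p (u i * u i * f i) = padic_abs p b"
      by (rule abs_eq_of_diff_less[OF N[OF that]])
    then have nz: "u i \<noteq> 0" "f i \<noteq> 0" using b abs_pos[OF b] by auto
    then have "padic_val p b = padic_val p (u i) + padic_val p (u i) + padic_val p (f i)"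
      using eq b by (subst (asm) abs_eq_iff_val) (auto simp: val_mult)
    then show ?thesis using nz by simp
  qed
  then show ?thesis by (auto simp: eventually_sequentially)
qed

lemma square_class_eq_valuation_rat:
  assumes "b \<noteq> 0" "square_class (Qp p) (Qp_of_rat p b) = square_class (Qp p) (Qp_of_rat p r)"
  shows "even (padic_val p b + padic_val p r)"
proof -
  have "\<forall>\<^sub>F i in sequentially. r \<noteq> 0 \<and> even (padic_val p b + padic_val p r)"
    by (rule square_class_eq_valuation[OF const_cauchy assms(1)])
      (use assms(2) in \<open>simp add: Qp_of_rat_def\<close>)
  then show ?thesis by simp
qed

section \<open>Local points\<close>

lemma selmer_local_infinity:
  assumes "padic_square b1" "padic_square b2"
  shows "selmer_local (Qp p) (Qp_of_rat p) e1 e2 e3 b1 b2"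
  unfolding selmer_local_def
proof (rule image_eqI[where x = Infinity])
  show "(square_class (Qp p) (Qp_of_rat p b1), square_class (Qp p) (Qp_of_rat p b2))
      = descent_map (Qp p) (Qp_of_rat p e1) (Qp_of_rat p e2) (Qp_of_rat p e3) Infinity"
    using square_class_eq_of_is_square[of b1 1] square_class_eq_of_is_square[of b2 1] assms
    by (simp add: descent_map_def of_rat_one)
qed (simp add: curve_points_def)

lemma torsion_point_on_curve:
  assumes "x \<in> {e1, e2, e3}"
  shows "Affine (Qp_of_rat p x) (Qp_of_rat p 0)
    \<in> curve_points (Qp p) (Qp_of_rat p e1) (Qp_of_rat p e2) (Qp_of_rat p e3)"
  using assms by (auto simp: curve_points_def simp flip: of_rat_mult of_rat_diff)

lemma selmer_local_e1:
  assumes "e1 \<noteq> e2" "padic_square (b1 * ((e1 - e2) * (e1 - e3)))" "padic_square (b2 * (e1 - e2))"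
  shows "selmer_local (Qp p) (Qp_of_rat p) e1 e2 e3 b1 b2"
  unfolding selmer_local_def
  by (rule image_eqI[OF _ torsion_point_on_curve[of e1]])
    (use assms square_class_eq_of_is_square[OF assms(2)] square_class_eq_of_is_square[OF assms(3)]
      in \<open>auto simp: descent_map_def simp flip: of_rat_mult of_rat_diff\<close>)

lemma selmer_local_e2:
  assumes "e1 \<noteq> e2" "padic_square (b1 * (e2 - e1))" "padic_square (b2 * ((e2 - e1) * (e2 - e3)))"
  shows "selmer_local (Qp p) (Qp_of_rat p) e1 e2 e3 b1 b2"
  unfolding selmer_local_def
  by (rule image_eqI[OF _ torsion_point_on_curve[of e2]])
    (use assms square_class_eq_of_is_square[OF assms(2)] square_class_eq_of_is_square[OF assms(3)]
      in \<open>auto simp: descent_map_def simp flip: of_rat_mult of_rat_diff\<close>)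

text \<open>The ordinate is the square root in the completion supplied by the second assumption. The
  abscissa \<open>e3\<close> is excluded there as well, since \<open>padic_square\<close> is false
  at 0.\<close>

lemma selmer_local_affine:
  assumes "x \<notin> {e1, e2}" "padic_square ((x - e1) * (x - e2) * (x - e3))"
    "padic_square (b1 * (x - e1))" "padic_square (b2 * (x - e2))"
  shows "selmer_local (Qp p) (Qp_of_rat p) e1 e2 e3 b1 b2"
proof -
  obtain y where y: "y \<in> carrier (Qp p)"
    "y \<otimes>\<^bsub>Qp p\<^esub> y = Qp_of_rat p ((x - e1) * (x - e2) * (x - e3))"
    using assms(2) by (auto simp: padic_square_def)
  then have "Affine (Qp_of_rat p x) y
      \<in> curve_points (Qp p) (Qp_of_rat p e1) (Qp_of_rat p e2) (Qp_of_rat p e3)"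
    by (simp add: curve_points_def of_rat_mult of_rat_diff)
  then show ?thesis
    unfolding selmer_local_def
    by (rule image_eqI[rotated])
      (use assms square_class_eq_of_is_square[OF assms(3)] square_class_eq_of_is_square[OF assms(4)]
        in \<open>auto simp: descent_map_def simp flip: of_rat_diff\<close>)
qed

lemma selmer_local_e3:
  assumes "e3 \<notin> {e1, e2}" "padic_square (b1 * (e3 - e1))" "padic_square (b2 * (e3 - e2))"
  shows "selmer_local (Qp p) (Qp_of_rat p) e1 e2 e3 b1 b2"
  unfolding selmer_local_def
  by (rule image_eqI[OF _ torsion_point_on_curve[of e3]])
    (use assms square_class_eq_of_is_square[OF assms(2)] square_class_eq_of_is_square[OF assms(3)]
      in \<open>auto simp: descent_map_def simp flip: of_rat_mult of_rat_diff\<close>)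

text \<open>The coordinates of a point over the completion are approximated by rational numbers, which
  satisfy the equation of the curve up to a factor close to \<open>1\<close>.\<close>

lemma selmer_local_cases:
  assumes sel: "selmer_local (Qp p) (Qp_of_rat p) e1 e2 e3 b1 b2"
    and b: "b1 \<noteq> 0" "b2 \<noteq> 0" and \<epsilon>: "\<epsilon> > 0"
  obtains (torsion) r1 r2 where
      "(r1, r2) \<in> {(1, 1), ((e1 - e2) * (e1 - e3), e1 - e2),
         (e2 - e1, (e2 - e1) * (e2 - e3)), (e3 - e1, e3 - e2)}"
      "even (padic_val p b1 + padic_val p r1)" "even (padic_val p b2 + padic_val p r2)"
  | (affine) x y where "x \<notin> {e1, e2, e3}"
      "even (padic_val p b1 + padic_val p (x - e1))" "even (padic_val p b2 + padic_val p (x - e2))"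
      "padic_abs p (y ^ 2 / ((x - e1) * (x - e2) * (x - e3)) - 1) < \<epsilon>"
proof -
  let ?\<iota> = "Qp_of_rat p" and ?s = "square_class (Qp p)"
  obtain P where P: "P \<in> curve_points (Qp p) (?\<iota> e1) (?\<iota> e2) (?\<iota> e3)"
    and c1: "?s (?\<iota> b1) = descent_component (Qp p) (?\<iota> e1) (?\<iota> e2) (?\<iota> e3) P"
    and c2: "?s (?\<iota> b2) = descent_component (Qp p) (?\<iota> e2) (?\<iota> e1) (?\<iota> e3) P"
    using sel by (auto simp: selmer_local_def descent_map_def)
  have tors: thesis
    if "(r1, r2) \<in> {(1, 1), ((e1 - e2) * (e1 - e3), e1 - e2),
        (e2 - e1, (e2 - e1) * (e2 - e3)), (e3 - e1, e3 - e2)}"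
      "?s (?\<iota> b1) = ?s (?\<iota> r1)" "?s (?\<iota> b2) = ?s (?\<iota> r2)" for r1 r2
    using torsion[OF that(1)] square_class_eq_valuation_rat[OF b(1) that(2)]
      square_class_eq_valuation_rat[OF b(2) that(3)] by blast
  show thesis
  proof (cases P)
    case Infinity
    then show thesis using c1 c2 by (intro tors[of 1 1]) (auto simp: of_rat_one)
  next
    case (Affine U V)
    have "U = ?\<iota> e1 \<or> (U = ?\<iota> e2 \<and> e1 \<noteq> e2) \<or> (U = ?\<iota> e3 \<and> e1 \<noteq> e3 \<and> e2 \<noteq> e3)
        \<or> U \<notin> {?\<iota> e1, ?\<iota> e2, ?\<iota> e3}" by auto
    then show thesis
    proof (elim disjE conjE)
      assume 1: "U = ?\<iota> e1"
      show thesis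
      proof (cases "e1 = e2")
        case True
        \<comment> \<open>If the first two roots coincide, the second component at this point is the
          class of 0, which contains no nonzero element.\<close>
        then have "?s (?\<iota> b2) = ?s (?\<iota> 0)"
          using c2 1 Affine by (simp flip: of_rat_mult of_rat_diff)
        then obtain u where "?\<iota> b2 = u \<otimes>\<^bsub>Qp p\<^esub> u \<otimes>\<^bsub>Qp p\<^esub> ?\<iota> 0" "u \<in> Units (Qp p)"
          using Q.square_class_eqD[of "?\<iota> b2" "?\<iota> 0"] of_rat_carrier by blast
        then have "?\<iota> b2 = ?\<iota> 0" by (simp add: of_rat_zero Q.Units_closed)
        then show thesis using b by simp
      next
        case False
        then show thesis
          using 1 c1 c2 Affine
          by (intro tors[of "(e1 - e2) * (e1 - e3)" "e1 - e2"])
            (simp_all flip: of_rat_mult of_rat_diff)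
      qed
    next
      assume 2: "U = ?\<iota> e2" "e1 \<noteq> e2"
      then show thesis
        using c1 c2 Affine by (intro tors[of "e2 - e1" "(e2 - e1) * (e2 - e3)"])
            (simp_all flip: of_rat_mult of_rat_diff)
    next
      assume 3: "U = ?\<iota> e3" "e1 \<noteq> e3" "e2 \<noteq> e3"
      then show thesis
        using c1 c2 Affine by (intro tors[of "e3 - e1" "e3 - e2"])
            (simp_all flip: of_rat_mult of_rat_diff)
    next
      assume 4: "U \<notin> {?\<iota> e1, ?\<iota> e2, ?\<iota> e3}"
      have UV: "U \<in> carrier (Qp p)" "V \<in> carrier (Qp p)"
        and eq: "V \<otimes>\<^bsub>Qp p\<^esub> V = (U \<ominus>\<^bsub>Qp p\<^esub> ?\<iota> e1) \<otimes>\<^bsub>Qp p\<^esub> (U \<ominus>\<^bsub>Qp p\<^esub> ?\<iota> e2) \<otimes>\<^bsub>Qp p\<^esub> (U \<ominus>\<^bsub>Qp p\<^esub> ?\<iota> e3)"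
        using P Affine by (auto simp: curve_points_def)
      obtain x where x: "x \<in> padic_cauchy p" "U = cls x" using UV by (auto simp: Qp_carrier)
      obtain y where y: "y \<in> padic_cauchy p" "V = cls y" using UV by (auto simp: Qp_carrier)
      have sub: "(\<lambda>i. x i - e) \<in> padic_cauchy p" for e
        by (rule cauchy_diff[OF x(1) const_cauchy])
      have Usub: "U \<ominus>\<^bsub>Qp p\<^esub> ?\<iota> e = cls (\<lambda>i. x i - e)" for e
        using x by (simp add: Qp_of_rat_def cls_minus const_cauchy)
      have prodc: "(\<lambda>i. (x i - e1) * (x i - e2) * (x i - e3)) \<in> padic_cauchy p"
        by (intro cauchy_mult sub)
      have ev1: "\<forall>\<^sub>F i in sequentially. even (padic_val p b1 + padic_val p (x i - e1))"
      proof -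
        have "?s (?\<iota> b1) = ?s (cls (\<lambda>i. x i - e1))" using c1 4 Affine by (simp add: Usub)
        from square_class_eq_valuation[OF sub b(1) this] show ?thesis
          by (rule eventually_mono) simp
      qed
      have ev2: "\<forall>\<^sub>F i in sequentially. even (padic_val p b2 + padic_val p (x i - e2))"
      proof -
        have "?s (?\<iota> b2) = ?s (cls (\<lambda>i. x i - e2))" using c2 4 Affine by (simp add: Usub)
        from square_class_eq_valuation[OF sub b(2) this] show ?thesis
          by (rule eventually_mono) simp
      qed
      have below: "\<exists>c>0. \<forall>\<^sub>F i in sequentially. padic_abs p (x i - e) \<ge> c" if "U \<noteq> ?\<iota> e" for e
      proof -
        have "(\<lambda>i. x i - e) \<notin> padic_null p"
          using that x by (simp add: Qp_of_rat_def cls_eq_iff const_cauchy)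
        then show ?thesis
          using cauchy_not_null_bounded_below[OF sub] unfolding eventually_sequentially by metis
      qed
      obtain a1 a2 a3 where a: "a1 > 0" "a2 > 0" "a3 > 0"
        and l: "\<forall>\<^sub>F i in sequentially. padic_abs p (x i - e1) \<ge> a1"
          "\<forall>\<^sub>F i in sequentially. padic_abs p (x i - e2) \<ge> a2"
          "\<forall>\<^sub>F i in sequentially. padic_abs p (x i - e3) \<ge> a3"
        using 4 below[of e1] below[of e2] below[of e3] by auto
      \<comment> \<open>A lower bound for the cubic along the tail: an absolute error below
        \<open>\<epsilon> * c\<close> in the equation becomes a relative error below
        \<open>\<epsilon>\<close>.\<close>
      define c where "c = a1 * a2 * a3"
      have c: "c > 0" using a by (simp add: c_def)
      have "cls (\<lambda>i. y i * y i) = cls (\<lambda>i. (x i - e1) * (x i - e2) * (x i - e3))"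
        using eq unfolding Usub by (simp add: y cls_mult cauchy_mult sub)
      then have "(\<lambda>i. y i * y i - (x i - e1) * (x i - e2) * (x i - e3)) \<in> padic_null p"
        by (simp add: y(1) cauchy_mult cls_eq_iff prodc)
      then have "\<forall>\<^sub>F i in sequentially.
          padic_abs p (y i * y i - (x i - e1) * (x i - e2) * (x i - e3)) < \<epsilon> * c"
        using \<epsilon> c by (auto simp: null_iff eventually_sequentially)
      with ev1 ev2 l have "\<forall>\<^sub>F i in sequentially. x i \<notin> {e1, e2, e3} \<and>
          even (padic_val p b1 + padic_val p (x i - e1)) \<and>
          even (padic_val p b2 + padic_val p (x i - e2)) \<and>
          padic_abs p (y i ^ 2 / ((x i - e1) * (x i - e2) * (x i - e3)) - 1) < \<epsilon>"
      proof eventually_elim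
        case (elim i)
        define m where "m = (x i - e1) * (x i - e2) * (x i - e3)"
        have "c \<le> padic_abs p m"
          unfolding m_def c_def abs_mult using elim a by (intro mult_mono) auto
        then have m0: "padic_abs p m > 0" "m \<noteq> 0" using c by auto
        have "y i ^ 2 / m - 1 = (y i * y i - m) / m"
          using m0 by (simp add: field_simps power2_eq_square)
        then have "padic_abs p (y i ^ 2 / m - 1) = padic_abs p (y i * y i - m) / padic_abs p m"
          by (simp add: abs_divide)
        moreover have "padic_abs p (y i * y i - m) < \<epsilon> * padic_abs p m"
          using elim(6) \<open>c \<le> padic_abs p m\<close> \<epsilon> mult_left_mono[of c "padic_abs p m" \<epsilon>]
          unfolding m_def by linarith
        ultimately have "padic_abs p (y i ^ 2 / m - 1) < \<epsilon>"
          using m0(1) by (simp add: divide_less_eq)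
        moreover have "x i \<notin> {e1, e2, e3}" using m0(2) by (auto simp: m_def)
        ultimately show ?case using elim(1,2) unfolding m_def by blast
      qed
      then obtain i where "x i \<notin> {e1, e2, e3} \<and>
          even (padic_val p b1 + padic_val p (x i - e1)) \<and>
          even (padic_val p b2 + padic_val p (x i - e2)) \<and>
          padic_abs p (y i ^ 2 / ((x i - e1) * (x i - e2) * (x i - e3)) - 1) < \<epsilon>"
        by (rule eventually_happens'[OF sequentially_bot, THEN exE])
      then show thesis using affine by blast
    qed
  qed
qed

end

section \<open>The quadratic character modulo an odd prime and its sums\<close>

locale odd_padic = padic +
  assumes odd_p: "odd p"
begin

abbreviation \<chi> :: "int \<Rightarrow> int" where "\<chi> x \<equiv> Legendre x (int p)"

lemma p_gt_2: "p > 2"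
  using odd_p prime_gt_1_nat[OF prime_p] by (cases "p = 2") auto

lemma chi_values: "\<chi> x \<in> {-1, 0, 1}"
  by (simp add: Legendre_def)

lemma chi_eq_0_iff: "\<chi> x = 0 \<longleftrightarrow> int p dvd x"
  by (simp add: Legendre_def cong_0_iff)

lemma chi_cong:
  assumes "[x = y] (mod int p)"
  shows "\<chi> x = \<chi> y"
proof -
  have "[x = 0] (mod int p) \<longleftrightarrow> [y = 0] (mod int p)"
    using assms cong_trans cong_sym by blast
  moreover have "QuadRes (int p) x \<longleftrightarrow> QuadRes (int p) y"
    unfolding QuadRes_def using assms cong_trans cong_sym by blast
  ultimately show ?thesis by (simp add: Legendre_def)
qed

lemma chi_mod: "\<chi> (x mod int p) = \<chi> x"
  by (rule chi_cong) simp

text \<open>Euler's criterion makes both sides congruent modulo p, and they differ by at most 2,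
  which is less than p.\<close>

lemma chi_mult: "\<chi> (x * y) = \<chi> x * \<chi> y"
proof -
  define k where "k = (p - 1) div 2"
  have e: "[\<chi> z = z ^ k] (mod int p)" for z
    unfolding k_def by (rule euler_criterion) (use prime_p p_gt_2 in auto)
  have "[\<chi> x * \<chi> y = (x * y) ^ k] (mod int p)"
    unfolding power_mult_distrib by (intro cong_mult e)
  then have "[\<chi> (x * y) = \<chi> x * \<chi> y] (mod int p)"
    using e[of "x * y"] cong_trans cong_sym by blast
  then have "int p dvd \<chi> (x * y) - \<chi> x * \<chi> y" by (simp add: cong_iff_dvd_diff)
  moreover have "\<bar>\<chi> (x * y) - \<chi> x * \<chi> y\<bar> \<le> 2"
    using chi_values[of "x * y"] chi_values[of x] chi_values[of y] by auto
  ultimately show ?thesis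
    using dvd_imp_le_int[of "\<chi> (x * y) - \<chi> x * \<chi> y" "int p"] p_gt_2 by fastforce
qed

lemma chi_1: "\<chi> 1 = 1"
proof -
  have "QuadRes (int p) 1" unfolding QuadRes_def by (rule exI[of _ 1]) simp
  moreover have "\<chi> 1 \<noteq> 0" using p_gt_2 by (auto simp: chi_eq_0_iff)
  ultimately show ?thesis by (simp add: Legendre_def split: if_splits)
qed

lemma padic_square_chi:
  assumes "\<chi> x = 1"
  shows "padic_square (of_int x)"
proof (rule padic_square_residue[OF odd_p])
  show "\<not> int p dvd x" using assms chi_eq_0_iff[of x] by auto
  show "QuadRes (int p) x" using assms by (auto simp: Legendre_def split: if_splits)
qed

lemma sum_residues_affine:
  fixes f :: "int \<Rightarrow> int"
  assumes "\<And>x. f (x mod int p) = f x" "\<not> int p dvd c"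
  shows "(\<Sum>x\<in>{0..<int p}. f (c * x + d)) = (\<Sum>x\<in>{0..<int p}. f x)"
proof -
  let ?h = "\<lambda>x. (c * x + d) mod int p"
  have "inj_on ?h {0..<int p}"
  proof (rule inj_onI)
    fix x y assume xy: "x \<in> {0..<int p}" "y \<in> {0..<int p}" "?h x = ?h y"
    then have "int p dvd (c * x + d) - (c * y + d)" by (simp add: mod_eq_dvd_iff)
    then have "int p dvd c * (x - y)" by (simp add: algebra_simps)
    then have "int p dvd x - y" using assms(2) prime_elem_p by (simp add: prime_elem_dvd_mult_iff)
    then show "x = y" using xy dvd_imp_le_int[of "x - y" "int p"] by fastforce
  qed
  moreover have "?h ` {0..<int p} \<subseteq> {0..<int p}" using p_gt_2 by auto
  ultimately have "bij_betw ?h {0..<int p} {0..<int p}"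
    using endo_inj_surj[of "{0..<int p}" ?h] by (simp add: bij_betw_def)
  from sum.reindex_bij_betw[OF this, of f] show ?thesis by (simp add: assms(1))
qed

text \<open>If every residue were a square, squaring would be a surjective and hence injective
  self-map of the residues; but 1 and p - 1 have the same square.\<close>

lemma nonresidue_exists: obtains g where "\<chi> g = -1"
proof -
  have "\<exists>g. \<chi> g = -1"
  proof (rule ccontr)
    assume "\<nexists>g. \<chi> g = -1"
    then have nres: "\<chi> x \<noteq> -1" for x by blast
    have res: "\<exists>y. [y ^ 2 = x] (mod int p)" for x
    proof (cases "int p dvd x")
      case True
      then have "[0 ^ 2 = x] (mod int p)" by (simp add: cong_iff_dvd_diff)
      then show ?thesis by blast
    next
      case False
      then show ?thesis using nres[of x]
        by (auto simp: Legendre_def QuadRes_def cong_0_iff split: if_splits)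
    qed
    let ?h = "\<lambda>y. y ^ 2 mod int p"
    have "{0..<int p} \<subseteq> ?h ` {0..<int p}"
    proof
      fix x assume x: "x \<in> {0..<int p}"
      obtain y where "[y ^ 2 = x] (mod int p)" using res by blast
      then have "(y mod int p) ^ 2 mod int p = x" using x by (simp add: cong_def power_mod)
      then show "x \<in> ?h ` {0..<int p}" using p_gt_2 by (intro image_eqI[of _ _ "y mod int p"]) auto
    qed
    then have inj: "inj_on ?h {0..<int p}"
      using finite_surj_inj[of "{0..<int p}" ?h] by simp
    have "?h 1 = ?h (int p - 1)"
      by (simp add: mod_eq_dvd_iff power2_eq_square algebra_simps)
    then have "1 = int p - 1" by (rule inj_onD[OF inj]) (use p_gt_2 in auto)
    then show False using p_gt_2 by simp
  qed
  then show thesis using that by blast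
qed

text \<open>Take the least natural number that is a nonresidue. Its predecessor is no nonresidue by
  minimality, and it is not 0 modulo p because 1 is a residue. The pair g, g - 1 provides abscissas
  at primes dividing n, where the cubic degenerates.\<close>

lemma nonresidue_after_residue: obtains g where "\<chi> g = -1" "\<chi> (g - 1) = 1"
proof -
  obtain h where h: "\<chi> h = -1" by (rule nonresidue_exists)
  have "\<chi> (int (nat (h mod int p))) = -1" using h p_gt_2 by (simp add: chi_mod)
  then obtain k where k: "\<chi> (int k) = -1" and least: "\<And>j. j < k \<Longrightarrow> \<chi> (int j) \<noteq> -1"
    using exists_least_iff[of "\<lambda>k. \<chi> (int k) = -1"] by blast
  have k0: "k \<noteq> 0"
  proof
    assume "k = 0"
    then show False using k chi_eq_0_iff[of 0] by simp
  qed
  have "\<chi> (int (k - 1)) \<noteq> -1" using k0 by (intro least) simp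
  then have "\<chi> (int k - 1) \<noteq> -1" using k0 by (simp add: of_nat_diff)
  moreover have "\<chi> (int k - 1) \<noteq> 0"
  proof
    assume "\<chi> (int k - 1) = 0"
    then have "[int k = 1] (mod int p)" by (simp add: chi_eq_0_iff cong_iff_dvd_diff)
    then show False using chi_cong k chi_1 by fastforce
  qed
  ultimately show thesis using that[of "int k"] k chi_values[of "int k - 1"] by auto
qed

text \<open>Multiplying the variable by a nonresidue permutes the residues and changes the sign of
  every term.\<close>

lemma sum_chi: "(\<Sum>x\<in>{0..<int p}. \<chi> x) = 0"
proof -
  obtain g where g: "\<chi> g = -1" by (rule nonresidue_exists)
  have "\<not> int p dvd g" using g chi_eq_0_iff[of g] by auto
  then have "(\<Sum>x\<in>{0..<int p}. \<chi> (g * x + 0)) = (\<Sum>x\<in>{0..<int p}. \<chi> x)"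
    by (intro sum_residues_affine chi_mod)
  then show ?thesis by (simp add: chi_mult g sum_negf)
qed

lemma sum_chi_shift: "(\<Sum>x\<in>{0..<int p}. \<chi> (x - e)) = 0"
  using sum_residues_affine[of \<chi> 1 "- e"] chi_mod p_gt_2 sum_chi by simp

lemma sum_chi_square: "(\<Sum>x\<in>{0..<int p}. \<chi> x * \<chi> x) = int p - 1"
proof -
  have "\<chi> x * \<chi> x = (if x = 0 then 0 else 1)" if "x \<in> {0..<int p}" for x
    using chi_values[of x] chi_eq_0_iff[of x] that zdvd_not_zless[of x "int p"] by auto
  then have "(\<Sum>x\<in>{0..<int p}. \<chi> x * \<chi> x) = (\<Sum>x\<in>{0..<int p}. if x = 0 then 0 else 1)"
    by (intro sum.cong) auto
  also have "\<dots> = (\<Sum>x\<in>{0..<int p} - {0}. 1)"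
    by (intro sum.mono_neutral_cong_right) auto
  also have "\<dots> = int p - 1" using p_gt_2 by (simp add: of_nat_diff)
  finally show ?thesis .
qed

text \<open>The sum over \<open>x\<close> is independent of the shift \<open>c\<close> as long as \<open>c\<close> is a unit, and it vanishes
  on average over all \<open>c\<close>.\<close>

lemma sum_chi_mult_shift:
  assumes "\<not> int p dvd c"
  shows "(\<Sum>x\<in>{0..<int p}. \<chi> x * \<chi> (x + c)) = -1"
proof -
  define S where "S c = (\<Sum>x\<in>{0..<int p}. \<chi> x * \<chi> (x + c))" for c
  have per: "\<chi> (x mod int p) * \<chi> (x mod int p + c) = \<chi> x * \<chi> (x + c)" for x c
    using chi_mod[of x] chi_cong[of "x mod int p + c" "x + c"]
    by (simp add: cong_def mod_add_left_eq)
  have S: "S c = S 1" if "\<not> int p dvd c" for c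
  proof -
    have c2: "\<chi> c * \<chi> c = 1" using that chi_values[of c] chi_eq_0_iff[of c] by auto
    \<comment> \<open>The substitution of c x for x extracts the factor
      \<open>\<chi> c * \<chi> c\<close>, which is 1.\<close>
    have "S c = (\<Sum>x\<in>{0..<int p}. \<chi> (c * x + 0) * \<chi> (c * x + 0 + c))"
      unfolding S_def
      by (rule sum_residues_affine[where f = "\<lambda>x. \<chi> x * \<chi> (x + c)", symmetric]) (rule per that)+
    also have "\<dots> = (\<Sum>x\<in>{0..<int p}. \<chi> x * \<chi> (x + 1))"
    proof (rule sum.cong)
      fix x
      have "\<chi> (c * x + 0) * \<chi> (c * x + 0 + c) = \<chi> (c * x) * \<chi> (c * (x + 1))"
        by (simp add: algebra_simps)
      also have "\<dots> = (\<chi> c * \<chi> c) * (\<chi> x * \<chi> (x + 1))" by (simp only: chi_mult) simp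
      finally show "\<chi> (c * x + 0) * \<chi> (c * x + 0 + c) = \<chi> x * \<chi> (x + 1)" by (simp add: c2)
    qed simp
    finally show ?thesis by (simp add: S_def)
  qed
  have "(\<Sum>c\<in>{0..<int p}. S c) = (\<Sum>x\<in>{0..<int p}. \<chi> x * (\<Sum>c\<in>{0..<int p}. \<chi> (c - (- x))))"
    unfolding S_def by (subst sum.swap) (simp add: sum_distrib_left add.commute)
  then have "(\<Sum>c\<in>{0..<int p}. S c) = 0" by (simp only: sum_chi_shift) simp
  moreover have "{0..<int p} = insert 0 {1..<int p}" using p_gt_2 by auto
  ultimately have "S 0 + (\<Sum>c\<in>{1..<int p}. S c) = 0" by simp
  moreover have "(\<Sum>c\<in>{1..<int p}. S c) = (\<Sum>c\<in>{1..<int p}. S 1)"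
    by (intro sum.cong S) (auto dest: zdvd_imp_le)
  moreover have "S 0 = int p - 1" using sum_chi_square by (simp add: S_def)
  ultimately have "(int p - 1) * (S 1 + 1) = 0" using p_gt_2 by (simp add: algebra_simps of_nat_diff)
  then have "S 1 = -1" using p_gt_2 by auto
  then show ?thesis using S[OF assms] by (simp add: S_def)
qed

lemma sum_chi_mult_shifts:
  assumes "\<not> int p dvd d - e"
  shows "(\<Sum>x\<in>{0..<int p}. \<chi> (x - d) * \<chi> (x - e)) = -1"
proof -
  have per: "\<chi> (x mod int p - d) * \<chi> (x mod int p - e) = \<chi> (x - d) * \<chi> (x - e)" for x
    using chi_cong[of "x mod int p - d" "x - d"] chi_cong[of "x mod int p - e" "x - e"]
    by (simp add: cong_def mod_diff_left_eq)
  have "(\<Sum>x\<in>{0..<int p}. \<chi> (x - d) * \<chi> (x - e))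
      = (\<Sum>x\<in>{0..<int p}. \<chi> (1 * x + d - d) * \<chi> (1 * x + d - e))"
    by (rule sum_residues_affine[where f = "\<lambda>x. \<chi> (x - d) * \<chi> (x - e)", symmetric])
      (use per p_gt_2 in auto)
  also have "\<dots> = (\<Sum>x\<in>{0..<int p}. \<chi> x * \<chi> (x + (d - e)))"
    by (simp add: algebra_simps)
  finally show ?thesis using sum_chi_mult_shift[OF assms] by simp
qed

text \<open>Up to a factor, the sum \<open>F a b\<close> below counts the points over the residue field whose descent
  class is \<open>(a, b)\<close>.  The cubic character sum enters each \<open>F a b\<close> in the same way, so that
  \<open>F a b - F 1 1\<close> is explicit; this replaces the Hasse bound.\<close>

lemma exists_residue_with_classes:
  assumes e: "\<not> int p dvd e1 - e2" "\<not> int p dvd e1 - e3" "\<not> int p dvd e2 - e3"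
    and ab: "a \<in> {1, -1}" "b \<in> {1, -1}" "(a, b) \<noteq> (1, 1)"
  obtains x where "\<chi> (x - e1) \<in> {0, a}" "\<chi> (x - e2) \<in> {0, b}" "\<chi> (x - e3) \<in> {0, a * b}"
proof -
  define t where "t a b x = (1 + a * \<chi> (x - e1)) * (1 + b * \<chi> (x - e2)) * (1 + a * b * \<chi> (x - e3))"
    for a b x
  define F where "F a b = (\<Sum>x\<in>{0..<int p}. t a b x)" for a b
  define S where "S = (\<Sum>x\<in>{0..<int p}. \<chi> (x - e1) * \<chi> (x - e2) * \<chi> (x - e3))"
  have F: "F a b = int p - (a + b + a * b) + S" if "a \<in> {1, -1}" "b \<in> {1, -1}" for a b
  proof -
    have "t a b x = 1 + a * \<chi> (x - e1) + b * \<chi> (x - e2) + a * b * \<chi> (x - e3)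
        + a * b * (\<chi> (x - e1) * \<chi> (x - e2)) + b * (\<chi> (x - e1) * \<chi> (x - e3))
        + a * (\<chi> (x - e2) * \<chi> (x - e3)) + \<chi> (x - e1) * \<chi> (x - e2) * \<chi> (x - e3)" for x
      using that by (auto simp: t_def algebra_simps)
    then show ?thesis
      unfolding F_def S_def using e
      by (simp add: sum.distrib sum_chi_shift sum_chi_mult_shifts flip: sum_distrib_left)
  qed
  have "t 1 1 x \<ge> 0" for x
    using chi_values[of "x - e1"] chi_values[of "x - e2"] chi_values[of "x - e3"]
    by (auto simp: t_def)
  then have "F 1 1 \<ge> 0" unfolding F_def by (simp add: sum_nonneg)
  \<comment> \<open>Since a + b + a b = (1 + a) (1 + b) - 1, this sum is 3 for a = b = 1 and -1
    otherwise; so \<open>F a b\<close> exceeds the nonnegative \<open>F 1 1\<close> by 4.\<close>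
  then have "F a b \<noteq> 0" using F[of 1 1] F[OF ab(1,2)] ab by auto
  then obtain x where x: "t a b x \<noteq> 0" unfolding F_def using sum.not_neutral_contains_not_neutral by blast
  \<comment> \<open>A factor such as 1 + a \<chi> vanishes exactly when \<chi> = -a, so a nonzero
    product leaves only the values 0 and a.\<close>
  have "\<chi> (x - e1) \<in> {0, a}" "\<chi> (x - e2) \<in> {0, b}" "\<chi> (x - e3) \<in> {0, a * b}"
    using x chi_values[of "x - e1"] chi_values[of "x - e2"] chi_values[of "x - e3"] ab
    by (auto simp: t_def)
  then show thesis using that by blast
qed

section \<open>Local points at odd primes\<close>

text \<open>A residue in the required class lifts to a point when it avoids the three roots modulo
  p. When it meets a root, the corresponding 2-torsion point replaces it: its class is read off the
  differences to the other two roots, and these are units with the right characters. The trivial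
  class, on which the character sum says nothing, comes from the point at infinity.\<close>

lemma selmer_local_good:
  assumes e: "\<not> int p dvd e1 - e2" "\<not> int p dvd e1 - e3" "\<not> int p dvd e2 - e3"
    and b: "\<not> int p dvd b1" "\<not> int p dvd b2"
  shows "selmer_local (Qp p) (Qp_of_rat p)
    (of_int e1) (of_int e2) (of_int e3) (of_int b1) (of_int b2)"
proof (cases "\<chi> b1 = 1 \<and> \<chi> b2 = 1")
  case True
  then show ?thesis by (intro selmer_local_infinity padic_square_chi) auto
next
  case False
  have pm: "\<chi> b1 \<in> {1, -1}" "\<chi> b2 \<in> {1, -1}"
    using b chi_values[of b1] chi_values[of b2] by (auto simp: chi_eq_0_iff)
  have ne: "e1 \<noteq> e2" "e1 \<noteq> e3" "e2 \<noteq> e3" using e by auto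
  obtain x where x: "\<chi> (x - e1) \<in> {0, \<chi> b1}" "\<chi> (x - e2) \<in> {0, \<chi> b2}"
      "\<chi> (x - e3) \<in> {0, \<chi> b1 * \<chi> b2}"
    using exists_residue_with_classes[OF e pm] False by auto
  have shift: "\<chi> (y - z) = \<chi> (x - z)" if "int p dvd x - y" for y z
    using that by (intro chi_cong) (simp add: cong_iff_dvd_diff dvd_diff_commute)
  have nz: "\<chi> (x - z) \<noteq> 0" if "int p dvd x - y" "\<not> int p dvd y - z" for y z
    using shift[OF that(1), of z] that(2) chi_eq_0_iff[of "y - z"] by auto
  have nz': "\<chi> (x - z) \<noteq> 0" if "int p dvd x - y" "\<not> int p dvd z - y" for y z
    using nz[OF that(1)] that(2) by (simp add: dvd_diff_commute)
  consider "int p dvd x - e1" | "int p dvd x - e2" | "int p dvd x - e3"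
    | "\<not> int p dvd x - e1" "\<not> int p dvd x - e2" "\<not> int p dvd x - e3" by blast
  from this show ?thesis
  proof cases
    case 1
    have "\<chi> (e1 - e2) = \<chi> b2" "\<chi> (e1 - e3) = \<chi> b1 * \<chi> b2"
      using shift[OF 1] nz[OF 1] x e by auto
    then have "\<chi> (b1 * ((e1 - e2) * (e1 - e3))) = 1" "\<chi> (b2 * (e1 - e2)) = 1"
      using pm by (auto simp: chi_mult)
    note this[THEN padic_square_chi]
    then show ?thesis using ne by (intro selmer_local_e1) simp_all
  next
    case 2
    have "\<chi> (e2 - e1) = \<chi> b1" "\<chi> (e2 - e3) = \<chi> b1 * \<chi> b2"
      using shift[OF 2] nz[OF 2] nz'[OF 2] x e by auto
    then have "\<chi> (b1 * (e2 - e1)) = 1" "\<chi> (b2 * ((e2 - e1) * (e2 - e3))) = 1"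
      using pm by (auto simp: chi_mult)
    note this[THEN padic_square_chi]
    then show ?thesis using ne by (intro selmer_local_e2) simp_all
  next
    case 3
    have "\<chi> (e3 - e1) = \<chi> b1" "\<chi> (e3 - e2) = \<chi> b2"
      using shift[OF 3] nz'[OF 3] x e by auto
    then have "\<chi> (b1 * (e3 - e1)) = 1" "\<chi> (b2 * (e3 - e2)) = 1"
      using pm by (auto simp: chi_mult)
    note this[THEN padic_square_chi]
    then show ?thesis using ne by (intro selmer_local_e3) simp_all
  next
    case 4
    then have "\<chi> (x - e1) = \<chi> b1" "\<chi> (x - e2) = \<chi> b2" "\<chi> (x - e3) = \<chi> b1 * \<chi> b2"
      using x chi_eq_0_iff by auto
    then have "\<chi> ((x - e1) * (x - e2) * (x - e3)) = 1" "\<chi> (b1 * (x - e1)) = 1" "\<chi> (b2 * (x - e2)) = 1"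
      using pm by (auto simp: chi_mult)
    note this[THEN padic_square_chi]
    moreover have "x \<noteq> e1" "x \<noteq> e2" using 4 by auto
    ultimately show ?thesis by (intro selmer_local_affine[of "of_int x"]) simp_all
  qed
qed

text \<open>Modulo p the cubic is x^2 (x - 1). At an x that is a nonresidue following a residue its
  value is therefore a nonzero square, while x and x - 1 lie in the classes of \<open>b1\<close> and
  \<open>b2\<close>.\<close>

lemma selmer_local_nonresidue:
  assumes N: "int p dvd N" and b1: "\<chi> b1 = -1" and b2: "\<chi> b2 = 1"
  shows "selmer_local (Qp p) (Qp_of_rat p) 0 1 (- (of_int N ^ 2)) (of_int b1) (of_int b2)"
proof -
  obtain g where g: "\<chi> g = -1" "\<chi> (g - 1) = 1" by (rule nonresidue_after_residue)
  have gN: "\<chi> (g + N ^ 2) = \<chi> g"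
    by (rule chi_cong) (use N in \<open>simp add: cong_iff_dvd_diff power2_eq_square\<close>)
  show ?thesis
  proof (rule selmer_local_affine[of "of_int g"])
    have "g \<noteq> 0" "g \<noteq> 1" using g chi_eq_0_iff[of 0] chi_1 by auto
    then show "(of_int g :: rat) \<notin> {0, 1}" by simp
    show "padic_square ((of_int g - 0) * (of_int g - 1) * (of_int g - - (of_int N ^ 2)))"
      using padic_square_chi[of "g * (g - 1) * (g + N ^ 2)"] g gN by (simp add: chi_mult)
    show "padic_square (of_int b1 * (of_int g - 0))"
      using padic_square_chi[of "b1 * g"] b1 g by (simp add: chi_mult)
    show "padic_square (of_int b2 * (of_int g - 1))"
      using padic_square_chi[of "b2 * (g - 1)"] b2 g by (simp add: chi_mult)
  qed
qed

text \<open>For p dividing \<open>b1\<close> the abscissa \<open>b1\<close> itself works: x - 1 is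
  near -1, a square, and with b1 = p c and N = p M the product x (x + N^2) is p^2 c (c + p M^2),
  where the last factor agrees with c modulo p. For a unit \<open>b1\<close> the point at infinity
  or the preceding construction applies.\<close>

lemma selmer_local_split:
  assumes N: "int p dvd N" "N \<noteq> 0" and m1: "\<chi> (-1) = 1"
    and b1: "b1 \<noteq> 0" "\<not> int p ^ 2 dvd b1" and b2: "\<chi> b2 = 1"
  shows "selmer_local (Qp p) (Qp_of_rat p) 0 1 (- (of_int N ^ 2)) (of_int b1) (of_int b2)"
proof (cases "int p dvd b1")
  case True
  obtain c where c: "b1 = int p * c" using True by auto
  obtain M where M: "N = int p * M" using N by auto
  have pc: "\<not> int p dvd c" using b1 c by (auto simp: power2_eq_square)
  have cc: "\<chi> c * \<chi> c = 1" using chi_values[of c] chi_eq_0_iff[of c] pc by auto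
  have x1: "\<chi> (b1 - 1) = 1"
    using chi_cong[of "b1 - 1" "-1"] m1 c by (simp add: cong_iff_dvd_diff)
  have x2: "\<chi> (c + int p * M ^ 2) = \<chi> c"
    by (rule chi_cong) (simp add: cong_iff_dvd_diff)
  show ?thesis
  proof (rule selmer_local_affine[of "of_int b1"])
    show "(of_int b1 :: rat) \<notin> {0, 1}"
      using b1 True p_gt_2 by (auto dest: zdvd_imp_le)
    have "padic_square (of_int (c * (b1 - 1) * (c + int p * M ^ 2)))"
      using cc by (intro padic_square_chi) (simp add: chi_mult x1 x2)
    then show "padic_square ((of_int b1 - 0) * (of_int b1 - 1) * (of_int b1 - - (of_int N ^ 2)))"
      by (rule padic_square_cong[where c = 1 and d = "of_int (int p)"])
        (use p_gt_2 in \<open>simp_all add: c M power2_eq_square algebra_simps\<close>)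
    show "padic_square (of_int b1 * (of_int b1 - 0))"
      using padic_square_power2[of "of_int b1"] b1 by (simp add: power2_eq_square)
    show "padic_square (of_int b2 * (of_int b1 - 1))"
      using padic_square_chi[of "b2 * (b1 - 1)"] b2 x1 by (simp add: chi_mult)
  qed
next
  case False
  show ?thesis
  proof (cases "\<chi> b1 = 1")
    case True
    then show ?thesis using b2 by (intro selmer_local_infinity padic_square_chi)
  next
    case c: False
    then have c: "\<chi> b1 = -1" using False chi_values[of b1] chi_eq_0_iff[of b1] by auto
    show ?thesis by (rule selmer_local_nonresidue[OF N(1) c b2])
  qed
qed

text \<open>The pair of characters of \<open>b1\<close> and \<open>b2\<close> has four values: (1,
  1) comes from infinity, (-1, 1) from the preceding construction, and (-1, -1) from the point (0,
  0), whose class is that of (-N^2, -1). Only (1, -1) requires a new point.\<close>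

lemma selmer_local_nonsplit:
  assumes N: "int p dvd N" "N \<noteq> 0" and m1: "\<chi> (-1) = -1"
    and b: "\<not> int p dvd b1" "\<not> int p dvd b2"
  shows "selmer_local (Qp p) (Qp_of_rat p) 0 1 (- (of_int N ^ 2)) (of_int b1) (of_int b2)"
proof -
  have N2: "padic_square (of_int N ^ 2)" using N by (intro padic_square_power2) simp
  have "\<chi> b1 = 1 \<or> \<chi> b1 = -1" "\<chi> b2 = 1 \<or> \<chi> b2 = -1"
    using b chi_values[of b1] chi_values[of b2] by (auto simp: chi_eq_0_iff)
  then consider "\<chi> b1 = 1" "\<chi> b2 = 1" | "\<chi> b1 = -1" "\<chi> b2 = 1"
    | "\<chi> b1 = -1" "\<chi> b2 = -1" | "\<chi> b1 = 1" "\<chi> b2 = -1" by blast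
  then show ?thesis
  proof cases
    case 1
    then show ?thesis by (intro selmer_local_infinity padic_square_chi)
  next
    case 2
    then show ?thesis by (intro selmer_local_nonresidue N)
  next
    case 3
    have "\<chi> (b1 * -1) = 1" "\<chi> (b2 * -1) = 1"
      by (simp_all only: chi_mult 3 m1)
    note sq = this[THEN padic_square_chi]
    show ?thesis
      using padic_square_mult[OF sq(1) N2] sq(2) by (intro selmer_local_e1) simp_all
  next
    case 4
    obtain g where g: "\<chi> g = -1" "\<chi> (g - 1) = 1" by (rule nonresidue_after_residue)
    \<comment> \<open>Scaling by N^2 turns x + N^2 into N^2 g. Up to squares the three factors x, x
      - 1 and x + N^2 become g - 1, -1 and g, with characters 1, -1 and -1.\<close>
    define x where "x = N ^ 2 * (g - 1)"
    have g1: "g \<noteq> 1" using g chi_1 by auto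
    have x1: "\<chi> (x - 1) = -1"
      using chi_cong[of "x - 1" "-1"] m1 N(1) by (simp add: x_def cong_iff_dvd_diff power2_eq_square)
    show ?thesis
    proof (rule selmer_local_affine[of "of_int x"])
      have "x \<noteq> 0" "x \<noteq> 1" using g1 N x1 chi_eq_0_iff[of 0] by (auto simp: x_def)
      then show "(of_int x :: rat) \<notin> {0, 1}" by simp
      have "padic_square (of_int ((g - 1) * (x - 1) * g))"
        using g x1 by (intro padic_square_chi) (simp add: chi_mult)
      then show "padic_square ((of_int x - 0) * (of_int x - 1) * (of_int x - - (of_int N ^ 2)))"
        by (rule padic_square_cong[where c = 1 and d = "of_int (N ^ 2)"])
          (use N in \<open>simp_all add: x_def power2_eq_square algebra_simps\<close>)
      have "padic_square (of_int (b1 * (g - 1)))"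
        using g 4 by (intro padic_square_chi) (simp add: chi_mult)
      then show "padic_square (of_int b1 * (of_int x - 0))"
        by (rule padic_square_cong[where c = 1 and d = "of_int N"])
          (use N in \<open>simp_all add: x_def power2_eq_square algebra_simps\<close>)
      show "padic_square (of_int b2 * (of_int x - 1))"
        using padic_square_chi[of "b2 * (x - 1)"] 4 x1 by (simp add: chi_mult)
    qed
  qed
qed

text \<open>Since N^2 = -1 modulo p, the sign of \<open>b2\<close> is a local square. So
  \<open>b2\<close> is trivial or has the class of p = 1 + N^2, and the latter is the second
  component at the 2-torsion point (1, 0), whose first component is 1.\<close>

lemma selmer_local_q:
  assumes q: "int p = N ^ 2 + 1" and b1: "\<chi> b1 = 1" and b2: "b2 \<in> {1, -1, int p, - int p}"
  shows "selmer_local (Qp p) (Qp_of_rat p) 0 1 (- (of_int N ^ 2)) (of_int b1) (of_int b2)"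
proof -
  have "[N ^ 2 = -1] (mod int p)" by (simp add: cong_iff_dvd_diff q)
  then have "QuadRes (int p) (-1)" by (auto simp: QuadRes_def)
  moreover have "\<not> [-1 = 0] (mod int p)" using p_gt_2 by (simp add: cong_0_iff)
  ultimately have m1: "\<chi> (-1) = 1" by (simp add: Legendre_def)
  have sb1: "padic_square (of_int b1)" by (rule padic_square_chi[OF b1])
  have sq: "padic_square (of_int c)" if "c \<in> {1, -1}" for c :: int
    using that m1 chi_1 by (auto intro!: padic_square_chi simp del: of_int_minus of_int_1)
  show ?thesis
  proof (cases "b2 \<in> {1, -1}")
    case True
    then show ?thesis using sb1 sq by (intro selmer_local_infinity) auto
  next
    case False
    then obtain c where c: "c \<in> {1, -1}" "b2 = c * int p"
      using b2 by (intro that[of "if b2 = int p then 1 else -1"]) auto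
    have P: "1 + of_int N ^ 2 = (of_int (int p) :: rat)" unfolding q by simp
    have "padic_square (of_int c * of_int (int p) ^ 2)"
      using sq[OF c(1)] p_gt_2 by (intro padic_square_mult padic_square_power2) auto
    then have "padic_square (of_int b2 * ((1 - 0) * (1 - - (of_int N ^ 2))))"
      using P by (simp add: c power2_eq_square mult.assoc)
    then show ?thesis using sb1 by (intro selmer_local_e2) simp_all
  qed
qed

end

section \<open>Local points at 2\<close>

context padic
begin

text \<open>The points with \<open>x = 5 / 4\<close> and \<open>x = 1 + 4 q\<close> differ by a point of order \<open>2\<close>, and so do those
  used in the second lemma; together with the torsion points they represent all eight classes.\<close>

lemma selmer_local_two_pos:
  assumes p: "p = 2" and N: "N mod 4 = 2"
    and b1: "b1 mod 8 \<in> {1, 5}" and b2: "b2 \<in> {1, N ^ 2 + 1}"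
  shows "selmer_local (Qp p) (Qp_of_rat p) 0 1 (- (of_int N ^ 2)) (of_int b1) (of_int b2)"
proof -
  note sq8 = padic_square_2adic[OF p]
  obtain k where k: "N = 4 * k + 2" using N by (metis mult_div_mod_eq)
  define w where "w = 4 * k ^ 2 + 4 * k + 1"
  \<comment> \<open>Here \<open>w\<close> is the square of N / 2, so that q = 4 w + 1 and 4 q + 1 =
    16 w + 5, which has the 2-adic square class of 5.\<close>
  have w: "N ^ 2 = 4 * w" by (simp add: k w_def power2_eq_square algebra_simps)
  define q where "q = 4 * w + 1"
  have q: "N ^ 2 + 1 = q" by (simp add: q_def w)
  have q0: "q \<noteq> 0" "1 + 4 * q \<noteq> 0" unfolding q_def by presburger+
  have wr: "of_int N ^ 2 = (4 * of_int w :: rat)" using w by (metis of_int_mult of_int_numeral of_int_power)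
  have qr: "(of_int q :: rat) = 4 * of_int w + 1" by (simp add: q_def)
  have w_of_q: "4 * of_int w = (of_int q - 1 :: rat)" by (simp add: q_def)
  have q5: "(4 * q + 1) mod 8 = 5" unfolding q_def by presburger
  show ?thesis
  proof (cases "b1 mod 8 = 1")
    case True
    then have sb1: "padic_square (of_int b1)" by (rule sq8)
    show ?thesis
    proof (cases "b2 = 1")
      case True
      then show ?thesis using sb1 sq8[of 1] by (intro selmer_local_infinity) auto
    next
      case False
      then have b2q: "b2 = q" using b2 q by auto
      have e: "1 - - (of_int N ^ 2) = (of_int q :: rat)" by (simp add: wr qr)
      have "padic_square (of_int q ^ 2)" using q0 by (intro padic_square_power2) simp
      then have "padic_square (of_int b2 * ((1 - 0) * (1 - - (of_int N ^ 2))))"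
        unfolding e b2q by (simp add: power2_eq_square)
      then show ?thesis using sb1 by (intro selmer_local_e2) simp_all
    qed
  next
    case False
    then have b15: "b1 mod 8 = 5" using b1 by auto
    show ?thesis
    proof (cases "b2 = 1")
      case True
      \<comment> \<open>At x = 5 / 4 the factor x - 1 = 1 / 4 is a square, while x and x + N^2 = (5
        + 16 w) / 4 both have the class of 5.\<close>
      show ?thesis
      proof (rule selmer_local_affine[of "5 / 4"])
        have "padic_square (of_int (5 * (5 + 16 * w)))" by (rule sq8) presburger
        then show "padic_square ((5 / 4 - 0) * (5 / 4 - 1) * (5 / 4 - - (of_int N ^ 2)))"
          by (rule padic_square_cong[where c = 8 and d = 1]) (simp_all add: wr algebra_simps)
        have "padic_square (of_int (5 * b1))" by (rule sq8) (use b15 in presburger)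
        then show "padic_square (of_int b1 * (5 / 4 - 0))"
          by (rule padic_square_cong[where c = 2 and d = 1]) simp_all
        show "padic_square (of_int b2 * (5 / 4 - 1))"
          using padic_square_power2[of "1 / 2"] by (simp add: True power2_eq_square)
      qed simp
    next
      case False
      then have b2: "b2 = q" using b2 q by auto
      \<comment> \<open>The abscissa 1 + q / (5 / 4 - 1) of the translate of the previous point by
        (1, 0). Here x - 1 = 4 q and x + N^2 = 5 q, so the cubic is 5 (4 q + 1) (2 q)^2.\<close>
      show ?thesis
      proof (rule selmer_local_affine[of "of_int (1 + 4 * q)"])
        have "padic_square (of_int (5 * (4 * q + 1)))" by (rule sq8) (use q5 in presburger)
        moreover have "padic_square ((2 * of_int q) ^ 2)" using q0 by (intro padic_square_power2) simp
        ultimately have "padic_square (of_int (5 * (4 * q + 1)) * (2 * of_int q) ^ 2)"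
          by (rule padic_square_mult)
        moreover have "(of_int (1 + 4 * q) - 0) * (of_int (1 + 4 * q) - 1) * (of_int (1 + 4 * q) - - (of_int N ^ 2))
            = of_int (5 * (4 * q + 1)) * (2 * of_int q :: rat) ^ 2"
          unfolding wr w_of_q by (simp add: power2_eq_square algebra_simps)
        ultimately show "padic_square ((of_int (1 + 4 * q) - 0) * (of_int (1 + 4 * q) - 1)
            * (of_int (1 + 4 * q) - - (of_int N ^ 2)))" by (simp only:)
        have "padic_square (of_int (b1 * (4 * q + 1)))"
          by (rule sq8) (use b15 q5 mod_mult_eq[of b1 8 "4 * q + 1"] in simp)
        then show "padic_square (of_int b1 * (of_int (1 + 4 * q) - 0))"
          by (simp add: add.commute)
        have "padic_square ((2 * of_int q) ^ 2)" using q0 by (intro padic_square_power2) simp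
        then show "padic_square (of_int b2 * (of_int (1 + 4 * q) - 1))"
          by (simp add: b2 power2_eq_square mult_ac)
        show "(of_int (1 + 4 * q) :: rat) \<notin> {0, 1}" using q0
          by (metis add.right_neutral add_left_cancel insertE mult_eq_0_iff of_int_0_eq_iff
              of_int_eq_1_iff singletonD zero_neq_numeral)
      qed
    qed
  qed
qed

lemma selmer_local_two_neg:
  assumes p: "p = 2" and N: "N mod 4 = 2"
    and b1: "b1 mod 8 \<in> {7, 3}" and b2: "b2 \<in> {-1, - (N ^ 2 + 1)}"
  shows "selmer_local (Qp p) (Qp_of_rat p) 0 1 (- (of_int N ^ 2)) (of_int b1) (of_int b2)"
proof -
  note sq8 = padic_square_2adic[OF p]
  obtain k where k: "N = 4 * k + 2" using N by (metis mult_div_mod_eq)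
  define w where "w = 4 * k ^ 2 + 4 * k + 1"
  have w: "N ^ 2 = 4 * w" by (simp add: k w_def power2_eq_square algebra_simps)
  define q where "q = 4 * w + 1"
  have q: "N ^ 2 + 1 = q" by (simp add: q_def w)
  have w0: "w \<noteq> 0" unfolding w_def by presburger
  have q0: "q \<noteq> 0" "4 * q + 1 \<noteq> 0" unfolding q_def by presburger+
  have w1: "16 * w + 5 \<noteq> 0" by presburger
  have wr: "of_int N ^ 2 = (4 * of_int w :: rat)" using w by (metis of_int_mult of_int_numeral of_int_power)
  have qr: "(of_int q :: rat) = 4 * of_int w + 1" by (simp add: q_def)
  have q5: "(16 * w + 5) mod 8 = 5" by presburger
  define W :: rat where "W = of_int w"
  have W0: "W \<noteq> 0" "16 * W + 5 \<noteq> 0" "4 * W + 1 \<noteq> 0"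
    using w0 w1 q0 unfolding W_def q_def
    by (metis of_int_0_eq_iff, metis (mono_tags) of_int_0_eq_iff of_int_add of_int_mult of_int_numeral,
        metis (mono_tags) of_int_0_eq_iff of_int_add of_int_mult of_int_numeral of_int_1)
  have N2: "padic_square (of_int N ^ 2)" using W0 by (intro padic_square_power2) (use wr W_def in auto)
  have wrW: "of_int N ^ 2 = 4 * W" by (simp add: wr W_def)
  have "padic_square (of_int (5 * (16 * w + 5)))" by (rule sq8) presburger
  then have s5: "padic_square (5 * (16 * W + 5))" by (simp add: W_def)
  show ?thesis
  proof (cases "b1 mod 8 = 7")
    case True
    have "padic_square (of_int (- b1))" by (rule sq8) (use True in presburger)
    note sb1 = padic_square_mult[OF this N2]
    show ?thesis
    proof (cases "b2 = -1")
      case True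
      then show ?thesis using sb1 sq8[of 1] by (intro selmer_local_e1) simp_all
    next
      case False
      then have b2q: "b2 = - q" using b2 q by auto
      have e: "- (of_int N ^ 2) - 1 = (- of_int q :: rat)" by (simp add: wr qr)
      have "padic_square (of_int q ^ 2)" using q0 by (intro padic_square_power2) simp
      then have "padic_square (of_int b2 * (- (of_int N ^ 2) - 1))"
        unfolding e b2q by (simp add: power2_eq_square)
      moreover have "- (of_int N ^ 2) \<notin> {0, 1 :: rat}"
        using W0 unfolding wr W_def by (auto simp: minus_equation_iff[of _ 1] eq_neg_iff_add_eq_0)
      ultimately show ?thesis using sb1 by (intro selmer_local_e3) simp_all
    qed
  next
    case False
    then have b13: "b1 mod 8 = 3" using b1 by auto
    show ?thesis
    proof (cases "b2 = -1")
      case True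
      \<comment> \<open>Translation by (0, 0) sends an abscissa x to -N^2 / x; this is the image of
        5 / 4.\<close>
      show ?thesis
      proof (rule selmer_local_affine[of "- 16 * W / 5"])
        have "(- 16 * W / 5 - 0) * (- 16 * W / 5 - 1) * (- 16 * W / 5 - - (of_int N ^ 2)) * 25 ^ 2
            = 5 * (16 * W + 5) * (8 * W) ^ 2"
          unfolding wrW by (simp add: power2_eq_square field_simps)
        from padic_square_cong[OF s5 _ this[symmetric]] W0(1)
        show "padic_square ((- 16 * W / 5 - 0) * (- 16 * W / 5 - 1) * (- 16 * W / 5 - - (of_int N ^ 2)))"
          by simp
        have "(- (5 * b1)) mod 8 = 1" using b13 by presburger
        note padic_square_mult[OF sq8[OF this] N2]
        moreover have "of_int (- (5 * b1)) * (of_int N ^ 2) * 2 ^ 2 = of_int b1 * (- 16 * W / 5 - 0) * 5 ^ 2"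
          unfolding wrW by simp
        ultimately show "padic_square (of_int b1 * (- 16 * W / 5 - 0))"
          using padic_square_cong[where c = 5 and d = 2] by (metis zero_neq_numeral)
        have "5 * (16 * W + 5) * 1 ^ 2 = of_int b2 * (- 16 * W / 5 - 1) * 5 ^ 2"
          unfolding True by (simp add: field_simps)
        then show "padic_square (of_int b2 * (- 16 * W / 5 - 1))"
          using padic_square_cong[OF s5, where c = 5 and d = 1] by (metis zero_neq_numeral zero_neq_one)
        show "- 16 * W / 5 \<notin> {0, 1}" using W0 by (auto simp: field_simps)
      qed
    next
      case False
      then have b2: "b2 = - q" using b2 q by auto
      \<comment> \<open>The image of 1 + 4 q = 16 w + 5 under the translation by (0, 0), that is
        -N^2 / (1 + 4 q).\<close>
      show ?thesis
      proof (rule selmer_local_affine[of "- 4 * W / (16 * W + 5)"])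
        have x1: "- 4 * W / (16 * W + 5) - 1 = - 5 * (4 * W + 1) / (16 * W + 5)"
          and x2: "- 4 * W / (16 * W + 5) + 4 * W = 16 * W * (4 * W + 1) / (16 * W + 5)"
          using W0 by (simp_all add: field_simps)
        have ident: "(- 4 * W / D) * (- 5 * E / D) * (16 * W * E / D) = 5 * D * (8 * W * E / D ^ 2) ^ 2"
          if "D \<noteq> 0" for D E using that by (simp add: power2_eq_square)
        have "(- 4 * W / (16 * W + 5)) * (- 5 * (4 * W + 1) / (16 * W + 5)) * (16 * W * (4 * W + 1) / (16 * W + 5))
            = 5 * (16 * W + 5) * (8 * W * (4 * W + 1) / (16 * W + 5) ^ 2) ^ 2"
          by (rule ident[OF W0(2)])
        moreover have "padic_square \<dots>"
          by (rule padic_square_mult[OF s5 padic_square_power2]) (use W0 in simp)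
        ultimately show "padic_square ((- 4 * W / (16 * W + 5) - 0) * (- 4 * W / (16 * W + 5) - 1)
            * (- 4 * W / (16 * W + 5) - - (of_int N ^ 2)))"
          by (simp only: x1 diff_0_right diff_minus_eq_add wrW x2)
        have "(- b1) mod 8 = 5" using b13 by presburger
        then have "padic_square (of_int (- b1 * (16 * w + 5)))"
          by (intro sq8) (use q5 mod_mult_eq[of "- b1" 8 "16 * w + 5"] in simp)
        then have "padic_square (of_int (- b1 * (16 * w + 5)) * of_int N ^ 2)" by (rule padic_square_mult[OF _ N2])
        moreover have "of_int (- b1 * (16 * w + 5)) * of_int N ^ 2 * 1 ^ 2
            = of_int b1 * (- 4 * W / (16 * W + 5) - 0) * (16 * W + 5) ^ 2"
          using W0 unfolding wrW by (simp add: W_def power2_eq_square)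
        ultimately show "padic_square (of_int b1 * (- 4 * W / (16 * W + 5) - 0))"
          using padic_square_cong[where c = "16 * W + 5" and d = 1] W0(2) by (metis zero_neq_one)
        have ident2: "5 * D * E ^ 2 = - E * (- 5 * E / D) * D ^ 2" if "D \<noteq> 0" for D E :: rat
          using that by (simp add: power2_eq_square)
        have "5 * (16 * W + 5) * (4 * W + 1) ^ 2 = of_int b2 * (- 4 * W / (16 * W + 5) - 1) * (16 * W + 5) ^ 2"
          unfolding x1 b2 of_int_minus qr W_def[symmetric] by (rule ident2[OF W0(2)])
        then show "padic_square (of_int b2 * (- 4 * W / (16 * W + 5) - 1))"
          using padic_square_cong[OF s5, where c = "16 * W + 5" and d = "4 * W + 1"] W0 by metis
        show "- 4 * W / (16 * W + 5) \<notin> {0, 1}" using W0 by (auto simp: field_simps)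
      qed
    qed
  qed
qed

section \<open>Necessary local conditions\<close>

lemma even_val_iff_power2:
  assumes "z \<noteq> 0" "padic_abs p (y ^ 2) = padic_abs p z"
  shows "even (padic_val p z)"
proof -
  have "y \<noteq> 0" using assms abs_pos[of z] by auto
  then have "padic_val p z = padic_val p (y ^ 2)"
    using assms by (simp add: abs_eq_iff_val)
  also have "\<dots> = 2 * padic_val p y" using \<open>y \<noteq> 0\<close> by (simp add: power2_eq_square val_mult)
  finally show ?thesis by simp
qed

lemma even_val_power2: "even (padic_val p (y ^ 2))"
proof (cases "y = 0")
  case True
  then show ?thesis by (simp add: padic_val_def)
next
  case False
  then show ?thesis by (simp add: power2_eq_square val_mult)
qed

lemma val_eq_0: "padic_abs p x = 1 \<Longrightarrow> padic_val p x = 0"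
  using abs_eq_iff_val[of x 1] val_1 by (cases "x = 0") auto

lemma abs_near_eq:
  assumes "m \<noteq> 0" "padic_abs p (y / m - 1) < 1"
  shows "padic_abs p y = padic_abs p m"
proof -
  have "padic_abs p (y / m) = 1" using abs_add_eq[of "y / m - 1" 1] assms by simp
  then show ?thesis using assms abs_pos[of m] by (simp add: abs_divide)
qed

section \<open>Parity of valuations for rational pairs that nearly satisfy the equation\<close>

context
  fixes N :: int and x y :: rat
  assumes x: "x \<notin> {0, 1, - (of_int N ^ 2)}"
    and y: "padic_abs p (y ^ 2 / (x * (x - 1) * (x + of_int N ^ 2)) - 1) < 1"
begin

lemma point_nz: "x \<noteq> 0" "x - 1 \<noteq> 0" "x + of_int N ^ 2 \<noteq> 0"
  using x by (auto simp: eq_neg_iff_add_eq_0)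

lemma abs_N2_le_1: "padic_abs p (of_int N ^ 2) \<le> 1"
  using abs_of_int_le_1[of "N ^ 2"] by simp

lemma even_val_sum:
  "even (padic_val p x + padic_val p (x - 1) + padic_val p (x + of_int N ^ 2))"
proof -
  have "padic_abs p (y ^ 2) = padic_abs p (x * (x - 1) * (x + of_int N ^ 2))"
    using point_nz y by (intro abs_near_eq) auto
  from even_val_iff_power2[OF _ this] show ?thesis
    using point_nz by (simp add: val_mult)
qed

text \<open>Far from the roots all three factors have the valuation of x, so three times this
  valuation is even.\<close>

lemma even_val_large:
  assumes "padic_abs p x > 1"
  shows "even (padic_val p x)" "even (padic_val p (x - 1))"
proof -
  have 1: "padic_abs p (x - 1) = padic_abs p x"
    using abs_add_eq[of "-1" x] assms by simp
  have 2: "padic_abs p (x + of_int N ^ 2) = padic_abs p x"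
    using abs_add_eq[of "of_int N ^ 2" x] assms abs_N2_le_1 by simp
  have "padic_val p (x - 1) = padic_val p x" "padic_val p (x + of_int N ^ 2) = padic_val p x"
    using 1 2 point_nz by (auto simp: abs_eq_iff_val)
  then show "even (padic_val p x)" "even (padic_val p (x - 1))" using even_val_sum by auto
qed

text \<open>The root 0 differs from 1 and from -N^2 by units. An x close to 0 thus makes the other
  two factors units, and the parity of the whole cubic falls on x alone.\<close>

lemma even_val_x_unit:
  assumes "\<not> int p dvd N"
  shows "even (padic_val p x)"
proof -
  have "padic_abs p (of_int N) = 1" using assms abs_of_int_eq_1_iff by blast
  then have N1: "padic_abs p (of_int N ^ 2) = 1" by (simp add: abs_power)
  consider "padic_abs p x > 1" | "padic_abs p x = 1" | "padic_abs p x < 1" by linarith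
  then show ?thesis
  proof cases
    case 1
    then show ?thesis by (rule even_val_large)
  next
    case 2
    then show ?thesis by (simp add: val_eq_0)
  next
    case 3
    then have "padic_abs p (x - 1) = 1" "padic_abs p (x + of_int N ^ 2) = 1"
      using abs_add_eq[of x "-1"] abs_add_eq[of x "of_int N ^ 2"] N1 by (simp_all add: add.commute)
    then show ?thesis using even_val_sum val_eq_0 by auto
  qed
qed

text \<open>The same isolation at the root 1, whose distance to the root -N^2 is 1 + N^2.\<close>

lemma even_val_x_minus_1:
  assumes "\<not> int p dvd N ^ 2 + 1"
  shows "even (padic_val p (x - 1))"
proof -
  have N1: "padic_abs p (of_int N ^ 2 + 1) = 1"
    using assms abs_of_int_eq_1_iff[of "N ^ 2 + 1"] by simp
  consider "padic_abs p x > 1" | "padic_abs p (x - 1) = 1"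
    | "padic_abs p x \<le> 1" "padic_abs p (x - 1) \<noteq> 1" by linarith
  then show ?thesis
  proof cases
    case 1
    then show ?thesis by (rule even_val_large)
  next
    case 2
    then show ?thesis by (simp add: val_eq_0)
  next
    case 3
    then have "padic_abs p (x - 1) < 1" using abs_diff_le[of x 1 1] by simp
    then have "padic_abs p x = 1" "padic_abs p (x + of_int N ^ 2) = 1"
      using abs_add_eq[of "x - 1" 1] abs_add_eq[of "x - 1" "of_int N ^ 2 + 1"] N1
      by (simp_all add: algebra_simps)
    then show ?thesis using even_val_sum val_eq_0 by auto
  qed
qed

text \<open>If \<open>x\<close> had odd valuation, it would have valuation \<open>1\<close>, and then \<open>(y / x)\<^sup>2\<close> would be
  close to \<open>-1\<close>.\<close>

lemma even_val_x_nonsplit: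
  assumes N: "padic_val p (of_int N) = 1"
    and \<delta>: "padic_abs p (y ^ 2 / (x * (x - 1) * (x + of_int N ^ 2)) - 1) \<le> \<delta>"
    and no_root: "\<And>z. \<not> padic_abs p (z ^ 2 + 1) \<le> \<delta>"
    and small: "padic_abs p x = padic_abs p (of_int N)
      \<Longrightarrow> padic_abs p (x + of_int N ^ 2 - of_int N ^ 2 / x) \<le> \<delta>"
  shows "even (padic_val p x)"
proof (rule ccontr)
  assume odd: "odd (padic_val p x)"
  have N0: "(of_int N :: rat) \<noteq> 0" using N by (auto simp: padic_val_def)
  have vN2: "padic_val p (of_int N ^ 2) = 2" using N N0 by (simp add: power2_eq_square val_mult)
  have "padic_abs p x \<le> 1" using odd even_val_large by force
  moreover have "padic_abs p x \<noteq> 1" using odd val_eq_0 by auto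
  ultimately have x1: "padic_abs p x < 1" by simp
  then have vx: "padic_val p x > 0" using abs_less_iff_val[of x 1] point_nz val_1 by simp
  have abs_x1: "padic_abs p (x - 1) = 1" using abs_add_eq[of x "-1"] x1 by simp
  then have "even (padic_val p x + padic_val p (x + of_int N ^ 2))"
    using even_val_sum val_eq_0 by auto
  then have odd': "odd (padic_val p (x + of_int N ^ 2))" using odd by simp
  \<comment> \<open>An x of valuation above 2 would give x + N^2 the even valuation 2.\<close>
  have "\<not> padic_abs p x < padic_abs p (of_int N ^ 2)"
  proof
    assume "padic_abs p x < padic_abs p (of_int N ^ 2)"
    then have "padic_abs p (of_int N ^ 2 + x) = padic_abs p (of_int N ^ 2)" by (rule abs_add_eq)
    then have "padic_val p (x + of_int N ^ 2) = 2"
      using point_nz N0 vN2 by (simp add: abs_eq_iff_val add.commute)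
    then show False using odd' by simp
  qed
  then have "padic_val p x \<le> 2" using abs_less_iff_val[of x "of_int N ^ 2"] point_nz N0 vN2 by simp
  moreover have "padic_val p x \<noteq> 2" using odd by auto
  ultimately have "padic_val p x = 1" using vx by linarith
  then have absx: "padic_abs p x = padic_abs p (of_int N)"
    using abs_eq_iff_val[of x "of_int N"] N N0 point_nz by simp
  define m where "m = x * (x - 1) * (x + of_int N ^ 2)"
  \<comment> \<open>The cubic divided by x^2. Multiplied by the ratio of y^2 to the cubic it gives
    (y / x)^2, and its own distance from -1 is the quantity bounded in \<open>small\<close>.\<close>
  define \<kappa> where "\<kappa> = (x - 1) * (x + of_int N ^ 2) / x"
  have "padic_abs p (of_int N ^ 2) < padic_abs p x"
    using abs_less_iff_val[of "of_int N ^ 2" x] point_nz N0 vN2 \<open>padic_val p x = 1\<close> by simp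
  then have "padic_abs p (x + of_int N ^ 2) = padic_abs p x" by (rule abs_add_eq)
  then have \<kappa>1: "padic_abs p \<kappa> = 1"
    using abs_pos[OF point_nz(1)] point_nz(1) by (simp add: \<kappa>_def abs_divide abs_mult abs_x1)
  have "(y / x) ^ 2 + 1 = \<kappa> * (y ^ 2 / m - 1) + (x + of_int N ^ 2 - of_int N ^ 2 / x)"
  proof -
    have "\<kappa> * (y ^ 2 / m) = (y / x) ^ 2"
      using point_nz by (simp add: \<kappa>_def m_def power2_eq_square)
    moreover have "\<kappa> + 1 = x + of_int N ^ 2 - of_int N ^ 2 / x"
      using point_nz(1) by (simp add: \<kappa>_def field_simps)
    ultimately show ?thesis by (simp add: algebra_simps)
  qed
  also have "padic_abs p \<dots> \<le> \<delta>"
    using \<delta> small[OF absx] by (intro abs_add_le) (simp_all add: abs_mult \<kappa>1 m_def)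
  finally show False using no_root by blast
qed

end

text \<open>If z^2 is close to -1, then z is integral and its denominator can be taken prime to p;
  clearing it turns an approximate root of -1 into a congruence for a sum of two squares.\<close>

lemma sum_squares_dvd:
  assumes "padic_abs p (z ^ 2 + 1) \<le> real p powi (- int e)" "e > 0"
  obtains a b where "int p ^ e dvd a ^ 2 + b ^ 2" "\<not> int p dvd b"
proof -
  have "real p powi (- int e) < 1"
    using p_gt_1 assms(2) by (simp add: power_int_minus field_simps)
  then have "padic_abs p (z ^ 2 + 1) < 1" using assms(1) by linarith
  then have "padic_abs p (z ^ 2) = 1" using abs_add_eq[of "z ^ 2 + 1" "-1"] by simp
  then have "padic_abs p z \<le> 1"
    unfolding abs_power by (metis abs_nonneg linorder_le_less_linear one_less_power pos2 less_irrefl)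
  then obtain a b where z: "z = of_int a / of_int b" and b: "\<not> int p dvd b" "b > 0"
    by (rule abs_le_1_cases)
  have "of_int (a ^ 2 + b ^ 2) = (z ^ 2 + 1) * of_int b ^ 2"
  proof -
    have "(z ^ 2 + 1) * of_int b ^ 2 = (z * of_int b) ^ 2 + of_int b ^ 2"
      by (simp add: power_mult_distrib distrib_right)
    also have "z * of_int b = of_int a" using b by (simp add: z)
    finally show ?thesis by simp
  qed
  then have "padic_abs p (of_int (a ^ 2 + b ^ 2)) = padic_abs p (z ^ 2 + 1) * padic_abs p (of_int b) ^ 2"
    by (simp only: abs_mult abs_power)
  also have "padic_abs p (of_int b) = 1" using b by (simp add: abs_of_int_eq_1_iff)
  finally have "padic_abs p (of_int (a ^ 2 + b ^ 2)) \<le> real p powi (- int e)" using assms by simp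
  then show thesis using that b unfolding abs_of_int_le_iff by blast
qed

text \<open>Modulo 2 the number -1 is a square, so the precision has to be 2^-2: with b odd, a^2 +
  b^2 is never divisible by 4.\<close>

lemma even_val_two:
  assumes p: "p = 2" and N: "padic_val p (of_int N) = 1" and x: "x \<notin> {0, 1, - (of_int N ^ 2)}"
    and y: "padic_abs p (y ^ 2 / (x * (x - 1) * (x + of_int N ^ 2)) - 1) < 1 / 4"
  shows "even (padic_val p x)"
proof (rule even_val_x_nonsplit[where \<delta> = "real p powi (- int 2)" and N = N])
  have \<delta>: "real p powi (- int 2) = 1 / 4" by (simp add: p power_int_minus)
  show "padic_abs p (y ^ 2 / (x * (x - 1) * (x + of_int N ^ 2)) - 1) < 1" using y by linarith
  show "padic_abs p (y ^ 2 / (x * (x - 1) * (x + of_int N ^ 2)) - 1) \<le> real p powi (- int 2)"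
    using y unfolding \<delta> by simp
  show "\<not> padic_abs p (z ^ 2 + 1) \<le> real p powi (- int 2)" for z
  proof
    assume "padic_abs p (z ^ 2 + 1) \<le> real p powi (- int 2)"
    then obtain a b where ab: "int p ^ 2 dvd a ^ 2 + b ^ 2" "\<not> int p dvd b"
      by (rule sum_squares_dvd) simp
    obtain k where k: "b = 2 * k + 1" using ab(2) p by (auto elim: oddE)
    obtain l where "a = 2 * l \<or> a = 2 * l + 1" by (metis evenE oddE)
    then have "a ^ 2 + b ^ 2 = 4 * (l ^ 2 + k ^ 2 + k) + 1 \<or> a ^ 2 + b ^ 2 = 4 * (l ^ 2 + l + k ^ 2 + k) + 2"
      by (auto simp: k power2_eq_square algebra_simps)
    moreover have "4 dvd a ^ 2 + b ^ 2" using ab(1) p by simp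
    ultimately show False by presburger
  qed
  have N0: "(of_int N :: rat) \<noteq> 0" using N by (auto simp: padic_val_def)
  have absN: "padic_abs p (of_int N) = 1 / 2"
    using N N0 by (simp add: padic_abs_def power_int_minus p)
  show "padic_abs p (x + of_int N ^ 2 - of_int N ^ 2 / x) \<le> real p powi (- int 2)"
    if ax: "padic_abs p x = padic_abs p (of_int N)"
  proof -
    have x0: "x \<noteq> 0" using x by auto
    \<comment> \<open>Separately x and N^2 / x have absolute value 1 / 2, which is too large. Their
      difference is (N / r) (r - 1) (r + 1), and for a 2-adic unit r both r - 1 and r + 1 are
      even.\<close>
    define r where "r = x / of_int N"
    have "padic_abs p r = 1" using ax absN N0 by (simp add: r_def abs_divide)
    then have "padic_abs p r \<le> 1" by simp
    then obtain a b where r: "r = of_int a / of_int b" and b: "\<not> int p dvd b" "b > 0"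
      by (rule abs_le_1_cases)
    have ab1: "padic_abs p (of_int b) = 1" using b by (simp add: abs_of_int_eq_1_iff)
    then have "padic_abs p (of_int a) = 1" using \<open>padic_abs p r = 1\<close> r by (simp add: abs_divide)
    then have "odd a" using abs_of_int_eq_1_iff[of a] p by simp
    moreover have "odd b" using b p by simp
    ultimately have ev: "even (a - b)" "even (a + b)" by auto
    have half: "padic_abs p (of_int c / of_int b) \<le> 1 / 2" if "even c" for c
      unfolding abs_divide ab1 using that abs_of_int_le_iff[of c 1] p by simp
    have "r - 1 = of_int (a - b) / of_int b" "r + 1 = of_int (a + b) / of_int b"
      using b by (simp_all add: r field_simps)
    then have "padic_abs p (r - 1) \<le> 1 / 2" "padic_abs p (r + 1) \<le> 1 / 2"
      by (simp_all only: half ev)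
    then have "padic_abs p (r - 1) * padic_abs p (r + 1) \<le> 1 / 2 * (1 / 2)"
      by (intro mult_mono) auto
    moreover have "x - of_int N ^ 2 / x = of_int N / r * ((r - 1) * (r + 1))"
      using x0 N0 by (simp add: r_def field_simps power2_eq_square)
    ultimately have "padic_abs p (x - of_int N ^ 2 / x) \<le> 1 / 4"
      using \<open>padic_abs p r = 1\<close> by (simp add: abs_mult abs_divide absN)
    moreover have "padic_abs p (of_int N ^ 2) \<le> 1 / 4"
      by (simp add: abs_mult absN power2_eq_square)
    ultimately have "padic_abs p (x - of_int N ^ 2 / x + of_int N ^ 2) \<le> 1 / 4" by (rule abs_add_le)
    then show ?thesis unfolding \<delta> by (simp add: algebra_simps)
  qed
qed (use N x in auto)

text \<open>The third claim takes the evenness for affine pairs as a hypothesis, because its proof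
  at 2 differs from the one at primes p = 3 mod 4. The precision 1 / 4 is the one that 2
  demands.\<close>

lemma selmer_local_even_val:
  assumes sel: "selmer_local (Qp p) (Qp_of_rat p) 0 1 (- (of_int N ^ 2)) b1 b2"
    and b: "b1 \<noteq> 0" "b2 \<noteq> 0"
  shows "\<not> int p dvd N ^ 2 + 1 \<Longrightarrow> even (padic_val p b2)"
    and "\<not> int p dvd N \<Longrightarrow> even (padic_val p b1)"
    and "(\<And>x y. x \<notin> {0, 1, - (of_int N ^ 2)} \<Longrightarrow>
        padic_abs p (y ^ 2 / (x * (x - 1) * (x + of_int N ^ 2)) - 1) < 1 / 4 \<Longrightarrow>
        even (padic_val p x)) \<Longrightarrow> even (padic_val p b1)"
proof -
  have "(even (padic_val p b1) \<and> (\<not> int p dvd N ^ 2 + 1 \<longrightarrow> even (padic_val p b2))) \<or>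
    (\<exists>x y. x \<notin> {0, 1, - (of_int N ^ 2)} \<and> even (padic_val p b1 + padic_val p x) \<and>
      even (padic_val p b2 + padic_val p (x - 1)) \<and>
      padic_abs p (y ^ 2 / (x * (x - 1) * (x + of_int N ^ 2)) - 1) < 1 / 4)"
    (is "_ \<or> ?affine")
  proof (cases rule: selmer_local_cases[OF sel b, of "1 / 4", simplified, case_names torsion affine])
    case (torsion r1 r2)
    have v1: "padic_val p (-1) = 0" using val_minus[of 1] val_1 by simp
    \<comment> \<open>On the 2-torsion the first component is 1 or -N^2, and the second is 1 or 1 +
      N^2 up to sign.\<close>
    have "even (padic_val p r1)"
      using torsion(1) val_1 v1 even_val_power2[of "of_int N"] val_minus[of "of_int N ^ 2"] by auto
    moreover have "even (padic_val p r2)" if "\<not> int p dvd N ^ 2 + 1"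
    proof -
      have "padic_val p (of_int (N ^ 2 + 1)) = 0"
        using that by (intro val_eq_0) (simp only: abs_of_int_eq_1_iff not_False_eq_True)
      then have "padic_val p (1 + of_int N ^ 2) = 0" by (simp add: add.commute)
      moreover have "- (of_int N ^ 2) - 1 = - (1 + of_int N ^ 2 :: rat)" by simp
      then have "padic_val p (- (of_int N ^ 2) - 1) = padic_val p (1 + of_int N ^ 2)"
        by (simp only: val_minus)
      ultimately show ?thesis using torsion(1) val_1 v1 by auto
    qed
    ultimately show ?thesis using torsion(2,3) by auto
  next
    case (affine x y)
    then have ?affine by (intro exI[of _ x] exI[of _ y]) auto
    then show ?thesis ..
  qed
  note cases = this
  show "even (padic_val p b2)" if "\<not> int p dvd N ^ 2 + 1"
    using cases
  proof (elim disjE exE conjE)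
    fix x y assume "x \<notin> {0, 1, - (of_int N ^ 2)}"
      "even (padic_val p b2 + padic_val p (x - 1))"
      "padic_abs p (y ^ 2 / (x * (x - 1) * (x + of_int N ^ 2)) - 1) < 1 / 4"
    then show ?thesis using even_val_x_minus_1[of x N y] that by auto
  qed (use that in blast)
  show "even (padic_val p b1)" if "\<not> int p dvd N"
    using cases
  proof (elim disjE exE conjE)
    fix x y assume "x \<notin> {0, 1, - (of_int N ^ 2)}"
      "even (padic_val p b1 + padic_val p x)"
      "padic_abs p (y ^ 2 / (x * (x - 1) * (x + of_int N ^ 2)) - 1) < 1 / 4"
    then show ?thesis using even_val_x_unit[of x N y] that by auto
  qed
  show "even (padic_val p b1)" if "\<And>x y. x \<notin> {0, 1, - (of_int N ^ 2)} \<Longrightarrow>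
        padic_abs p (y ^ 2 / (x * (x - 1) * (x + of_int N ^ 2)) - 1) < 1 / 4 \<Longrightarrow>
        even (padic_val p x)"
    using cases
  proof (elim disjE exE conjE)
    fix x y assume "x \<notin> {0, 1, - (of_int N ^ 2)}"
      "even (padic_val p b1 + padic_val p x)"
      "padic_abs p (y ^ 2 / (x * (x - 1) * (x + of_int N ^ 2)) - 1) < 1 / 4"
    then show ?thesis using that[of x y] by auto
  qed
qed

end

context odd_padic
begin

text \<open>Precision 1 / p is enough: if p divides a^2 + b^2 with b prime to p, then the character
  of -1 would have to be 1.\<close>

lemma even_val_nonsplit:
  assumes m1: "\<chi> (-1) = -1" and N: "padic_val p (of_int N) = 1"
    and x: "x \<notin> {0, 1, - (of_int N ^ 2)}"
    and y: "padic_abs p (y ^ 2 / (x * (x - 1) * (x + of_int N ^ 2)) - 1) < 1 / 4"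
  shows "even (padic_val p x)"
proof (rule even_val_x_nonsplit[where \<delta> = "real p powi (- int 1)" and N = N])
  have \<delta>: "real p powi (- int 1) = inverse (real p)" by simp
  show y1: "padic_abs p (y ^ 2 / (x * (x - 1) * (x + of_int N ^ 2)) - 1) < 1" using y by linarith
  then show "padic_abs p (y ^ 2 / (x * (x - 1) * (x + of_int N ^ 2)) - 1) \<le> real p powi (- int 1)"
    unfolding \<delta> by (simp add: abs_less_1)
  show "\<not> padic_abs p (z ^ 2 + 1) \<le> real p powi (- int 1)" for z
  proof
    assume "padic_abs p (z ^ 2 + 1) \<le> real p powi (- int 1)"
    then obtain a b where ab: "int p ^ 1 dvd a ^ 2 + b ^ 2" "\<not> int p dvd b"
      by (rule sum_squares_dvd) simp
    have "\<chi> (a * a) = \<chi> (-1 * (b * b))"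
      by (rule chi_cong) (use ab(1) in \<open>simp add: cong_iff_dvd_diff power2_eq_square\<close>)
    then have "\<chi> a * \<chi> a = - (\<chi> b * \<chi> b)" by (simp only: chi_mult m1)
    moreover have "\<chi> b * \<chi> b = 1" using chi_values[of b] ab(2) chi_eq_0_iff[of b] by auto
    ultimately show False using zero_le_square[of "\<chi> a"] by linarith
  qed
  have N0: "(of_int N :: rat) \<noteq> 0" using N by (auto simp: padic_val_def)
  have absN: "padic_abs p (of_int N) = inverse (real p)"
    using N N0 by (simp add: padic_abs_def power_int_minus)
  show "padic_abs p (x + of_int N ^ 2 - of_int N ^ 2 / x) \<le> real p powi (- int 1)"
    if ax: "padic_abs p x = padic_abs p (of_int N)"
  proof -
    have p1: "inverse (real p) \<le> 1" using p_gt_1 by (simp add: field_simps)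
    have "padic_abs p (of_int N ^ 2 / x) = inverse (real p)"
      using ax absN p_gt_1 by (simp add: abs_divide abs_mult power2_eq_square)
    moreover have "padic_abs p (of_int N ^ 2) \<le> inverse (real p)"
      using absN p1 p_gt_1 by (simp add: abs_mult power2_eq_square mult_left_le)
    ultimately show ?thesis
      unfolding \<delta> using ax absN by (intro abs_diff_le abs_add_le) simp_all
  qed
qed (use N x in auto)

lemma chi_minus_1:
  "\<chi> (-1) = (if p mod 4 = 1 then 1 else -1)"
proof -
  define c :: int where "c = (if p mod 4 = 1 then 1 else -1)"
  have "[\<chi> (-1) = (-1) ^ ((p - 1) div 2)] (mod int p)"
    by (rule euler_criterion) (use prime_p p_gt_2 in auto)
  moreover have "even ((p - 1) div 2) \<longleftrightarrow> p mod 4 = 1" using odd_p by presburger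
  ultimately have dvd: "int p dvd \<chi> (-1) - c"
    by (auto simp: cong_iff_dvd_diff c_def)
  have "\<bar>\<chi> (-1) - c\<bar> \<le> 2"
    using chi_values[of "-1"] by (auto simp: c_def)
  then have "\<chi> (-1) - c = 0"
    using dvd_imp_le_int[OF _ dvd] p_gt_2 by linarith
  then show ?thesis by (simp add: c_def)
qed

end

section \<open>The global Selmer group\<close>

lemma type_algebra_simps:
  "carrier (ring_of_type_algebra :: 'a::field ring) = UNIV"
  "x \<otimes>\<^bsub>(ring_of_type_algebra :: 'a ring)\<^esub> y = x * y"
  "\<one>\<^bsub>(ring_of_type_algebra :: 'a ring)\<^esub> = 1"
  "x \<ominus>\<^bsub>(ring_of_type_algebra :: 'a ring)\<^esub> y = x - y"
proof -
  interpret R: cring "ring_of_type_algebra :: 'a ring" by (rule cring_from_type_algebra)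
  have "\<ominus>\<^bsub>(ring_of_type_algebra :: 'a ring)\<^esub> y = - y"
    by (rule R.minus_equality) (simp_all add: ring_of_type_algebra_def)
  then show "x \<ominus>\<^bsub>(ring_of_type_algebra :: 'a ring)\<^esub> y = x - y"
    by (simp add: a_minus_def) (simp add: ring_of_type_algebra_def)
qed (simp_all add: ring_of_type_algebra_def)

lemma square_class_type_algebra:
  "square_class (ring_of_type_algebra :: 'a::field ring) a = {u * u * a | u. u \<noteq> 0}"
proof -
  interpret R: cring "ring_of_type_algebra :: 'a ring" by (rule cring_from_type_algebra)
  have "Units (ring_of_type_algebra :: 'a ring) = {u. u \<noteq> 0}"
    using field.field_Units[OF field_from_type_algebra[where 'a = 'a]]
    by (auto simp: ring_of_type_algebra_def)
  then show ?thesis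
    unfolding R.unit_squares_simps by (auto simp: type_algebra_simps)
qed

lemma square_class_type_algebra_eq_iff:
  "square_class (ring_of_type_algebra :: 'a::field ring) a = square_class ring_of_type_algebra b
    \<longleftrightarrow> (\<exists>u. u \<noteq> 0 \<and> a = u * u * b)"
proof
  assume "square_class (ring_of_type_algebra :: 'a ring) a = square_class ring_of_type_algebra b"
  moreover have "a \<in> square_class (ring_of_type_algebra :: 'a ring) a"
    unfolding square_class_type_algebra by (auto intro!: exI[of _ 1])
  ultimately show "\<exists>u. u \<noteq> 0 \<and> a = u * u * b" by (auto simp: square_class_type_algebra)
next
  assume "\<exists>u. u \<noteq> 0 \<and> a = u * u * b"
  then obtain u where u: "u \<noteq> 0" "a = u * u * b" by blast
  have "\<exists>v. w * w * a = v * v * b \<and> v \<noteq> 0" if "w \<noteq> 0" for w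
    using u that by (intro exI[of _ "w * u"]) (simp add: mult_ac)
  moreover have "\<exists>v. w * w * b = v * v * a \<and> v \<noteq> 0" if "w \<noteq> 0" for w
    using u that by (intro exI[of _ "w / u"]) (simp add: field_simps)
  ultimately show "square_class (ring_of_type_algebra :: 'a ring) a = square_class ring_of_type_algebra b"
    unfolding square_class_type_algebra by (intro equalityI subsetI) force+
qed

lemma square_class_real_eqI:
  fixes a b :: real
  assumes "a * b > 0"
  shows "square_class ring_of_type_algebra a = square_class ring_of_type_algebra b"
  unfolding square_class_type_algebra_eq_iff
proof (intro exI conjI)
  have ab: "a / b > 0" using assms by (simp add: zero_less_mult_iff zero_less_divide_iff)
  show "sqrt (a / b) \<noteq> 0" using real_sqrt_gt_zero[OF ab] by (metis less_irrefl)
  have "b \<noteq> 0" using assms by auto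
  moreover have "sqrt (a / b) * sqrt (a / b) = a / b"
    using ab by (simp only: real_sqrt_mult_self abs_of_pos)
  ultimately show "a = sqrt (a / b) * sqrt (a / b) * b" by simp
qed

lemma square_class_real_eqD:
  fixes a b :: real
  assumes "square_class ring_of_type_algebra a = square_class ring_of_type_algebra b"
  shows "a > 0 \<longleftrightarrow> b > 0"
proof -
  obtain u where "u \<noteq> 0" "a = u * u * b" using assms by (auto simp: square_class_type_algebra_eq_iff)
  then show ?thesis using not_real_square_gt_zero[of u] by (simp add: zero_less_mult_iff)
qed

text \<open>A real point cannot have 0 < x < 1, where the cubic is negative; outside this interval x
  and x - 1 have the same sign. The points at which a component is defined separately are checked
  one by one.\<close>

lemma selmer_local_real_sign:
  assumes "selmer_local (ring_of_type_algebra :: real ring) of_rat 0 1 (- (of_int N ^ 2)) b1 b2"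
  shows "b1 > 0 \<longleftrightarrow> b2 > 0"
proof -
  let ?R = "ring_of_type_algebra :: real ring"
  have e: "(of_rat (- (of_int N ^ 2)) :: real) = - (of_int N ^ 2)"
    by (simp add: of_rat_minus of_rat_power)
  obtain P where P: "P \<in> curve_points ?R 0 1 (- (of_int N ^ 2))"
    and c1: "square_class ?R (of_rat b1) = descent_component ?R 0 1 (- (of_int N ^ 2)) P"
    and c2: "square_class ?R (of_rat b2) = descent_component ?R 1 0 (- (of_int N ^ 2)) P"
    using assms by (auto simp: selmer_local_def descent_map_def e)
  have N: "(of_int N :: real) ^ 2 \<ge> 0" by simp
  show ?thesis
  proof (cases P)
    case Infinity
    then show ?thesis
      using c1 c2 square_class_real_eqD[of "of_rat b1" 1] square_class_real_eqD[of "of_rat b2" 1]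
      by (simp add: type_algebra_simps)
  next
    case (Affine x y)
    have eq: "y * y = x * (x - 1) * (x + of_int N ^ 2)"
      using P Affine by (simp add: curve_points_def type_algebra_simps)
    consider "x = 0" | "x = 1" | "x \<noteq> 0" "x \<noteq> 1" by blast
    then show ?thesis
    proof cases
      case 1
      then show ?thesis
        using c1 c2 Affine N square_class_real_eqD[of "of_rat b1"] square_class_real_eqD[of "of_rat b2"]
        by (simp add: type_algebra_simps)
    next
      case 2
      have "1 + (of_int N :: real) ^ 2 > 0" using N by linarith
      then show ?thesis
        using 2 c1 c2 Affine square_class_real_eqD[of "of_rat b1" 1]
          square_class_real_eqD[of "of_rat b2" "1 + of_int N ^ 2"]
        by (simp add: type_algebra_simps)
    next
      case 3
      have "\<not> (0 < x \<and> x < 1)"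
      proof
        assume "0 < x \<and> x < 1"
        then have "x * (1 - x) * (x + of_int N ^ 2) > 0" by (intro mult_pos_pos add_pos_nonneg N) auto
        moreover have "x * (1 - x) * (x + of_int N ^ 2) = - (y * y)"
          unfolding eq by (simp add: algebra_simps)
        ultimately show False using zero_le_square[of y] by linarith
      qed
      then have "x > 0 \<longleftrightarrow> x - 1 > 0" using 3 by auto
      then show ?thesis
        using c1 c2 Affine 3 square_class_real_eqD[of "of_rat b1" x]
          square_class_real_eqD[of "of_rat b2" "x - 1"]
        by (simp add: type_algebra_simps)
    qed
  qed
qed

text \<open>Positive pairs come from infinity, negative ones from (0, 0), whose class is that of
  (-N^2, -1).\<close>

lemma selmer_local_realI:
  assumes "N \<noteq> 0" "b1 * b2 > 0"
  shows "selmer_local (ring_of_type_algebra :: real ring) of_rat 0 1 (- (of_int N ^ 2)) b1 b2"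
proof -
  let ?R = "ring_of_type_algebra :: real ring"
  have e: "(of_rat (- (of_int N ^ 2)) :: real) = - (of_int N ^ 2)"
    by (simp add: of_rat_minus of_rat_power)
  show ?thesis
  proof (cases "b1 > 0")
    case True
    then have "b2 > 0" using assms by (simp add: zero_less_mult_iff)
    then have "square_class ?R (of_rat b1) = square_class ?R 1"
        "square_class ?R (of_rat b2) = square_class ?R 1"
      using True by (auto intro!: square_class_real_eqI)
    then show ?thesis unfolding selmer_local_def e
      by (intro image_eqI[of _ _ Infinity])
        (simp_all add: descent_map_def type_algebra_simps curve_points_def)
  next
    case False
    then have "b1 < 0" "b2 < 0" using assms by (auto simp: zero_less_mult_iff)
    then have "square_class ?R (of_rat b1) = square_class ?R (- (of_int N ^ 2))"
        "square_class ?R (of_rat b2) = square_class ?R (- 1)"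
      using assms by (auto intro!: square_class_real_eqI simp: mult_neg_pos)
    then show ?thesis unfolding selmer_local_def e
      by (intro image_eqI[of _ _ "Affine 0 0"])
        (simp_all add: descent_map_def type_algebra_simps curve_points_def)
  qed
qed

text \<open>The fraction a / b is a square as soon as the integer a b is, and a positive integer
  with even multiplicities is a square.\<close>

lemma rat_square_of_even_val:
  assumes r: "r > 0"
    and ev: "\<And>p. Factorial_Ring.prime p \<Longrightarrow> even (padic_val p r)"
  obtains u where "u \<noteq> 0" "r = u * u"
proof -
  obtain a b where ab: "quotient_of r = (a, b)" by fastforce
  have b: "b > 0" and req: "r = of_int a / of_int b"
    using quotient_of_denom_pos[OF ab] quotient_of_div[OF ab] by auto
  have a: "a > 0" using r b by (simp add: req zero_less_divide_iff)
  have "2 dvd multiplicity \<pi> (a * b)" if "Factorial_Ring.prime \<pi>" for \<pi> :: int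
  proof -
    have \<pi>: "\<pi> = int (nat \<pi>)" "Factorial_Ring.prime (nat \<pi>)"
      using that prime_ge_0_int[of \<pi>] by auto
    interpret padic "nat \<pi>" by unfold_locales (rule \<pi>(2))
    have "of_int (a * b) = r * (of_int b * of_int b)" using b by (simp add: req)
    then have "padic_val (nat \<pi>) (of_int (a * b)) = padic_val (nat \<pi>) (r * (of_int b * of_int b))"
      by (rule arg_cong)
    also have "\<dots> = padic_val (nat \<pi>) r + 2 * padic_val (nat \<pi>) (of_int b)"
      using r b by (simp add: val_mult)
    finally have "even (int (multiplicity \<pi> (a * b)))"
      using ev[OF \<pi>(2)] by (simp only: val_of_int \<pi>(1)[symmetric]) simp
    then show ?thesis by simp
  qed
  then have "is_nth_power 2 (normalize (a * b))"
    by (subst is_nth_power_conv_multiplicity) auto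
  then obtain c where c: "a * b = c ^ 2" using a b by (auto elim!: is_nth_powerE simp: abs_mult)
  have "r = (of_int c / of_int b) * (of_int c / of_int b)"
  proof -
    have "(of_int c :: rat) * of_int c = of_int a * of_int b"
      using c by (metis of_int_mult power2_eq_square)
    then show ?thesis using b by (simp add: req field_simps)
  qed
  moreover have "c \<noteq> 0" using c a b by auto
  ultimately show thesis using that[of "of_int c / of_int b"] b by simp
qed

text \<open>Sign and parities of valuations form a complete invariant of a rational square class;
  this makes parity statements sufficient for the upper bound.\<close>

lemma square_class_rat_eqI:
  fixes a b :: rat
  assumes "a * b > 0"
    and "\<And>p. Factorial_Ring.prime p \<Longrightarrow> even (padic_val p a + padic_val p b)"
  shows "square_class ring_of_type_algebra a = square_class ring_of_type_algebra b"
proof -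
  have nz: "a \<noteq> 0" "b \<noteq> 0" using assms(1) by auto
  have "even (padic_val p (a * b))" if "Factorial_Ring.prime p" for p
  proof -
    interpret padic p by unfold_locales (rule that)
    show ?thesis using assms(2)[OF that] nz by (simp add: val_mult)
  qed
  then obtain u where "u \<noteq> 0" "a * b = u * u" using rat_square_of_even_val[OF assms(1)] by blast
  then have "a = (u / b) * (u / b) * b" "u / b \<noteq> 0" using nz by (auto simp: field_simps)
  then show ?thesis unfolding square_class_type_algebra_eq_iff by blast
qed

lemma square_class_rat_eqD:
  fixes a b :: rat
  assumes "square_class ring_of_type_algebra a = square_class ring_of_type_algebra b" "b \<noteq> 0"
  shows "a > 0 \<longleftrightarrow> b > 0"
    and "Factorial_Ring.prime p \<Longrightarrow> even (padic_val p a + padic_val p b)"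
proof -
  obtain u where u: "u \<noteq> 0" "a = u * u * b" using assms by (auto simp: square_class_type_algebra_eq_iff)
  have "u * u > 0" using u by (simp add: zero_less_mult_iff) linarith
  then show "a > 0 \<longleftrightarrow> b > 0" unfolding u(2) by (simp add: zero_less_mult_iff)
  assume "Factorial_Ring.prime p"
  then interpret padic p by unfold_locales
  show "even (padic_val p a + padic_val p b)" using u assms(2) by (simp add: val_mult)
qed

section \<open>The representatives of the Selmer classes and their number\<close>

locale en_curve =
  fixes n q :: nat
  assumes n_pos: "n > 0" and n_squarefree: "squarefree n" and n_even: "even n"
    and q_prime: "Factorial_Ring.prime q" and q_eq: "n\<^sup>2 + 1 = q"
begin

text \<open>Among the odd primes dividing n these are the ones at which the node of the reduced
  curve has rational tangents, that is, split multiplicative reduction.\<close>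

definition split_primes :: "nat set" where
  "split_primes = {p \<in> prime_factors n. p mod 4 = 1}"

lemma finite_split_primes: "finite split_primes"
  by (simp add: split_primes_def)

lemma split_primesD:
  assumes "p \<in> split_primes"
  shows "Factorial_Ring.prime p" "p dvd n" "p mod 4 = 1"
  using assms by (auto simp: split_primes_def in_prime_factors_iff)

lemma split_primesI:
  assumes "Factorial_Ring.prime p" "p dvd n" "p mod 4 = 1"
  shows "p \<in> split_primes"
  using assms n_pos by (auto simp: split_primes_def in_prime_factors_iff)

lemma n_mod_4: "n mod 4 = 2"
proof -
  have "\<not> 2 ^ 2 dvd n" using squarefreeD[OF n_squarefree, of 2] by auto
  then show ?thesis using n_even by simp presburger
qed

lemma q_eq_int: "int q = int n ^ 2 + 1"
  using q_eq by (metis of_nat_1 of_nat_add of_nat_power)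

lemma q_mod_4: "q mod 4 = 1"
proof -
  obtain k where "n = 2 * k" using n_even by blast
  then have "q = 4 * (k * k) + 1" using q_eq by (simp add: power2_eq_square)
  then show ?thesis by presburger
qed

lemma q_odd: "odd q"
  using q_mod_4 by presburger

lemma q_coprime_n: "Factorial_Ring.prime p \<Longrightarrow> p dvd n \<Longrightarrow> \<not> int p dvd int n ^ 2 + 1"
  using not_prime_unit[of p]
  by (metis dvd_add_right_iff dvd_power int_dvd_int_iff of_nat_1 of_nat_dvd_iff dvd_trans pos2)

lemma dvd_q_iff: "Factorial_Ring.prime p \<Longrightarrow> int p dvd int n ^ 2 + 1 \<longleftrightarrow> p = q"
  using q_prime primes_dvd_imp_eq by (auto simp flip: q_eq_int)

lemma val_n:
  assumes "Factorial_Ring.prime p" "p dvd n"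
  shows "padic_val p (of_int (int n)) = 1"
proof -
  interpret padic p by unfold_locales (rule assms)
  have "\<not> p ^ 2 dvd n" using squarefreeD[OF n_squarefree] not_prime_unit assms(1) by blast
  then have "\<not> int (p ^ 2) dvd int n" unfolding int_dvd_int_iff .
  then have "\<not> int p ^ Suc 1 dvd int n" by (simp add: power2_eq_square)
  moreover have "int p ^ 1 dvd int n" using assms(2) by simp
  ultimately have "multiplicity (int p) (int n) = 1" by (rule multiplicity_eqI[rotated])
  then show ?thesis by (simp only: val_of_int)
qed

definition split_prod :: "nat set \<Rightarrow> int" where
  "split_prod T = int (\<Prod>T)"

lemma split_prod_empty [simp]: "split_prod {} = 1"
  by (simp add: split_prod_def)

lemma split_prod_insert [simp]:
  "finite T \<Longrightarrow> l \<notin> T \<Longrightarrow> split_prod (insert l T) = int l * split_prod T"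
  by (simp add: split_prod_def)

lemma split_prod_pos: "T \<subseteq> split_primes \<Longrightarrow> split_prod T > 0"
  unfolding split_prod_def of_nat_0_less_iff
  using split_primesD(1) prime_gt_0_nat by (intro prod_pos) auto

lemma val_split_prod:
  assumes "T \<subseteq> split_primes" "Factorial_Ring.prime p"
  shows "padic_val p (of_int (split_prod T)) = (if p \<in> T then 1 else 0)"
proof -
  interpret padic p by unfold_locales (rule assms)
  have "finite T" using assms(1) finite_split_primes finite_subset by blast
  then show ?thesis using assms(1)
  proof (induction T)
    case empty
    then show ?case using val_1 by simp
  next
    case (insert l T)
    have l: "Factorial_Ring.prime l" using insert split_primesD by blast
    have vl: "padic_val p (of_int (int l)) = (if p = l then 1 else 0)"
    proof (cases "p = l")
      case True
      then show ?thesis unfolding val_of_int using prime_elem_p by simp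
    next
      case False
      then have "\<not> p dvd l" using primes_dvd_imp_eq assms(2) l by blast
      then have "multiplicity (int p) (int l) = 0" by (intro not_dvd_imp_multiplicity_0) simp
      then show ?thesis unfolding val_of_int using False by simp
    qed
    have "(of_int (split_prod (insert l T)) :: rat) = of_int (int l) * of_int (split_prod T)"
      using insert.hyps by simp
    moreover have "(of_int (int l) :: rat) \<noteq> 0" "(of_int (split_prod T) :: rat) \<noteq> 0"
      using prime_gt_0_nat[OF l] split_prod_pos[of T] insert.prems by auto
    ultimately have "padic_val p (of_int (split_prod (insert l T)))
        = padic_val p (of_int (int l)) + padic_val p (of_int (split_prod T))"
      by (metis val_mult)
    also have "\<dots> = (if p = l then 1 else 0) + (if p \<in> T then 1 else 0)"
      using insert vl by simp
    finally show ?case using insert.hyps by auto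
  qed
qed

lemma split_prod_mod_4:
  assumes "T \<subseteq> split_primes"
  shows "split_prod T mod 4 = 1"
proof -
  have "finite T" using assms finite_split_primes finite_subset by blast
  then show ?thesis using assms
  proof (induction T)
    case (insert l T)
    then have "l mod 4 = 1" "split_prod T mod 4 = 1" using split_primesD by auto
    moreover from this have "int l mod 4 = 1" by presburger
    ultimately show ?case using insert.hyps mod_mult_eq[of "int l" 4 "split_prod T"] by simp
  qed simp
qed

text \<open>Each prime l in the product divides n, so q = n^2 + 1 is 1 modulo l and hence a residue.
  Because q = 1 mod 4, reciprocity has no sign, and l is a residue modulo q.\<close>

lemma Legendre_split_prod:
  assumes "T \<subseteq> split_primes"
  shows "Legendre (split_prod T) (int q) = 1"
proof -
  interpret q: odd_padic q by unfold_locales (use q_prime q_odd in auto)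
  have "finite T" using assms finite_split_primes finite_subset by blast
  then show ?thesis using assms
  proof (induction T)
    case empty
    then show ?case using q.chi_1 by simp
  next
    case (insert l T)
    then have l: "Factorial_Ring.prime l" "l dvd n" "l mod 4 = 1" using split_primesD by auto
    have "odd l" using l(3) by presburger
    then interpret l: odd_padic l by unfold_locales (use l in auto)
    have "[int q = 1] (mod int l)"
      using l(2) by (simp add: q_eq_int cong_iff_dvd_diff power2_eq_square)
    then have "Legendre (int q) (int l) = 1" using l.chi_cong l.chi_1 by metis
    moreover have "l \<noteq> q" using q_coprime_n[OF l(1,2)] q_eq_int by auto
    then have "Legendre (int l) (int q) * Legendre (int q) (int l) = (-1) ^ ((l - 1) div 2 * ((q - 1) div 2))"
      using l(1) q_prime l.p_gt_2 q.p_gt_2 by (intro Quadratic_Reciprocity) auto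
    moreover have "even ((q - 1) div 2)" using q_mod_4 by presburger
    ultimately have "Legendre (int l) (int q) = 1" by simp
    then show ?case using insert by (simp add: q.chi_mult)
  qed
qed

lemma selmer_local_representative:
  assumes \<epsilon>: "\<epsilon> \<in> {1, -1}" and T: "T \<subseteq> split_primes" and c: "c \<in> {1, int q}"
    and p: "Factorial_Ring.prime p"
  shows "selmer_local (Qp p) (Qp_of_rat p) 0 1 (- (of_int (int n) ^ 2))
    (of_int (\<epsilon> * split_prod T)) (of_int (\<epsilon> * c))"
proof -
  interpret padic p by unfold_locales (rule p)
  define D where "D = split_prod T"
  have D0: "D > 0" using split_prod_pos[OF T] by (simp add: D_def)
  have pD: "int p dvd D \<longleftrightarrow> p \<in> T"
  proof -
    have "padic_val p (of_int D) = (if p \<in> T then 1 else 0)"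
      unfolding D_def by (rule val_split_prod[OF T p])
    then have "multiplicity (int p) D = (if p \<in> T then 1 else 0)"
      by (simp add: val_of_int split: if_splits)
    then show ?thesis
      using prime_elem_multiplicity_eq_zero_iff[OF prime_elem_p, of D] D0 by (auto split: if_splits)
  qed
  have pe: "int p dvd \<epsilon> * k \<longleftrightarrow> int p dvd k" for k using \<epsilon> by auto
  show ?thesis
  proof (cases "p = 2")
    case True
    have N: "int n mod 4 = 2" using n_mod_4 by presburger
    have "D mod 4 = 1" using split_prod_mod_4[OF T] unfolding D_def .
    \<comment> \<open>All prime factors of the product are 1 modulo 4, which places it in the
      classes that the points at 2 realise.\<close>
    then have D: "D mod 8 \<in> {1, 5}" by simp presburger
    show ?thesis
    proof (cases "\<epsilon> = 1")
      case e: True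
      show ?thesis using selmer_local_two_pos[OF True N D, of c] c
        by (simp add: e q_eq_int flip: D_def)
    next
      case False
      then have e: "\<epsilon> = -1" using \<epsilon> by simp
      have "(- D) mod 8 \<in> {7, 3}" using D by simp presburger
      moreover have "- c \<in> {-1, - (int n ^ 2 + 1)}" using c q_eq_int by auto
      ultimately show ?thesis using selmer_local_two_neg[OF True N, of "- D" "- c"]
        by (simp add: e flip: D_def)
    qed
  next
    case False
    then have "odd p" using p primes_dvd_imp_eq two_is_prime_nat by blast
    interpret odd_padic p by unfold_locales fact
    have sq: "\<chi> x * \<chi> x = 1" if "\<not> int p dvd x" for x
      using that chi_values[of x] chi_eq_0_iff[of x] by auto
    have N0: "int n \<noteq> 0" using n_pos by simp
    show ?thesis
    proof (cases "p dvd n")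
      case pn: True
      have pN: "int p dvd int n" using pn by simp
      have qn: "\<not> int p dvd int q" using q_coprime_n[OF p pn] by (simp add: q_eq_int)
      show ?thesis
      proof (cases "p mod 4 = 1")
        case True
        then have m1: "\<chi> (-1) = 1" by (simp add: chi_minus_1)
        have "[int q = 1] (mod int p)"
          using pn by (simp add: q_eq_int cong_iff_dvd_diff power2_eq_square)
        then have "\<chi> (int q) = 1" using chi_cong chi_1 by metis
        \<comment> \<open>Both -1 and q are residues at this prime, so all four possible second
          components are local squares.\<close>
        then have ec: "\<chi> (\<epsilon> * c) = 1"
          unfolding chi_mult using \<epsilon> c m1 chi_1 by auto
        have "\<not> int p ^ 2 dvd \<epsilon> * D"
        proof
          assume "int p ^ 2 dvd \<epsilon> * D"
          then have "int p ^ 2 dvd D" using \<epsilon> by auto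
          then have "2 \<le> multiplicity (int p) D"
            using D0 prime_elem_not_unit[OF prime_elem_p] by (intro multiplicity_geI) auto
          moreover have "padic_val p (of_int D) \<le> 1"
            unfolding D_def using val_split_prod[OF T p] by simp
          ultimately show False by (simp add: val_of_int)
        qed
        then show ?thesis
          unfolding D_def[symmetric]
          using D0 \<epsilon> by (intro selmer_local_split pN N0 m1 ec) auto
      next
        case False
        then have "\<chi> (-1) = -1" by (simp add: chi_minus_1)
        moreover have "p \<notin> T" using False T split_primesD(3) by blast
        moreover have "\<not> int p dvd \<epsilon> * c" using c qn p_gt_2 unfolding pe by auto
        ultimately show ?thesis
          unfolding D_def[symmetric] using pD pe by (intro selmer_local_nonsplit pN N0) auto
      qed
    next
      case pn: False
      have pN: "\<not> int p dvd int n" using pn by simp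
      have pT: "p \<notin> T" using pn T split_primesD(2) by blast
      show ?thesis
      proof (cases "p = q")
        case True
        have "\<chi> (-1) = 1" unfolding chi_minus_1 using q_mod_4 True by simp
        then have "\<chi> (\<epsilon> * D) = 1"
          unfolding chi_mult D_def using \<epsilon> Legendre_split_prod[OF T] True chi_1 by auto
        then show ?thesis
          unfolding D_def[symmetric] using \<epsilon> c True q_eq_int by (intro selmer_local_q) auto
      next
        case False
        have pq: "\<not> int p dvd int q" using False p q_prime primes_dvd_imp_eq by auto
        have "selmer_local (Qp p) (Qp_of_rat p) (of_int 0) (of_int 1) (of_int (- (int n ^ 2)))
            (of_int (\<epsilon> * D)) (of_int (\<epsilon> * c))"
        proof (rule selmer_local_good)
          show "\<not> int p dvd 0 - 1" using p_gt_2 by simp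
          show "\<not> int p dvd 0 - - (int n ^ 2)"
            using pN prime_elem_dvd_power[OF prime_elem_p, of "int n" 2] by auto
          show "\<not> int p dvd 1 - - (int n ^ 2)" using pq by (simp add: q_eq_int add.commute)
          show "\<not> int p dvd \<epsilon> * D" using pT pD pe by simp
          show "\<not> int p dvd \<epsilon> * c" using c pq p_gt_2 unfolding pe by auto
        qed
        then show ?thesis by (simp add: D_def)
      qed
    qed
  qed
qed

lemma selmer_even_val:
  assumes "selmer_local (Qp p) (Qp_of_rat p) 0 1 (- (of_int (int n) ^ 2)) b1 b2"
    and b: "b1 \<noteq> 0" "b2 \<noteq> 0" and p: "Factorial_Ring.prime p"
  shows "p \<notin> split_primes \<Longrightarrow> even (padic_val p b1)"
    and "p \<noteq> q \<Longrightarrow> even (padic_val p b2)"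
proof -
  interpret padic p by unfold_locales (rule p)
  note ev = selmer_local_even_val[OF assms(1) b]
  show "even (padic_val p b2)" if "p \<noteq> q"
    using that dvd_q_iff[OF p] by (intro ev(1)) simp
  show "even (padic_val p b1)" if "p \<notin> split_primes"
  proof (cases "p dvd n")
    case False
    then show ?thesis by (intro ev(2)) simp
  next
    case pn: True
    \<comment> \<open>Squarefreeness enters here: n has valuation exactly 1, so an odd valuation of
      x between 0 and 2 has to agree with that of n.\<close>
    note v = val_n[OF p pn]
    show ?thesis
    proof (cases "p = 2")
      case True
      show ?thesis by (rule ev(3)) (rule even_val_two[OF True v])
    next
      case False
      then have "odd p" using p primes_dvd_imp_eq two_is_prime_nat by blast
      interpret odd_padic p by unfold_locales fact
      have "p mod 4 \<noteq> 1" using that split_primesI[OF p pn] by blast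
      then have "\<chi> (-1) = -1" by (simp add: chi_minus_1)
      then show ?thesis by (intro ev(3)) (rule even_val_nonsplit[OF _ v])
    qed
  qed
qed

definition representative :: "int \<times> nat set \<times> int \<Rightarrow> rat set \<times> rat set" where
  "representative = (\<lambda>(\<epsilon>, T, c). (square_class ring_of_type_algebra (of_int (\<epsilon> * split_prod T)),
     square_class ring_of_type_algebra (of_int (\<epsilon> * c))))"

lemma val_c:
  assumes "Factorial_Ring.prime p" "c \<in> {1, int q}" "\<epsilon> \<in> {1, -1}"
  shows "padic_val p (of_int (\<epsilon> * c)) = (if p = q \<and> c = int q then 1 else 0)"
proof -
  interpret padic p by unfold_locales (rule assms)
  have "padic_val p (of_int (\<epsilon> * c)) = padic_val p (of_int c)"
    using assms(3) val_minus[of "of_int c"] by auto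
  also have "\<dots> = (if p = q \<and> c = int q then 1 else 0)"
  proof (cases "p = q \<and> c = int q")
    case True
    then show ?thesis using prime_elem_p val_of_int[of c] by simp
  next
    case False
    then have "\<not> int p dvd c"
      using assms(2) primes_dvd_imp_eq[OF assms(1) q_prime] prime_gt_1_nat[OF assms(1)] by auto
    then have "padic_val p (of_int c) = 0"
      by (simp add: val_of_int not_dvd_imp_multiplicity_0)
    then show ?thesis using False by (simp only: if_False)
  qed
  finally show ?thesis .
qed

lemma val_representative:
  assumes "Factorial_Ring.prime p" "T \<subseteq> split_primes" "\<epsilon> \<in> {1, -1}"
  shows "padic_val p (of_int (\<epsilon> * split_prod T)) = (if p \<in> T then 1 else 0)"
proof -
  interpret padic p by unfold_locales (rule assms)
  have "padic_val p (of_int (\<epsilon> * split_prod T)) = padic_val p (of_int (split_prod T))"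
    using assms(3) val_minus[of "of_int (split_prod T)"] by auto
  then show ?thesis using val_split_prod[OF assms(2,1)] by simp
qed

abbreviation representatives :: "(int \<times> nat set \<times> int) set" where
  "representatives \<equiv> {1, -1} \<times> Pow split_primes \<times> {1, int q}"

text \<open>The sign of the second component recovers \<open>\<epsilon>\<close>, its parity at q
  recovers \<open>c\<close>, and the parities of the first component recover
  \<open>T\<close>.\<close>

lemma inj_representative: "inj_on representative representatives"
proof (rule inj_onI)
  fix r s assume "r \<in> representatives" "s \<in> representatives" and eq: "representative r = representative s"
  then obtain \<epsilon> T c \<epsilon>' T' c' where r: "r = (\<epsilon>, T, c)" and s: "s = (\<epsilon>', T', c')"
    and e: "\<epsilon> \<in> {1, -1}" "\<epsilon>' \<in> {1, -1}" and T: "T \<subseteq> split_primes" "T' \<subseteq> split_primes"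
    and c: "c \<in> {1, int q}" "c' \<in> {1, int q}" by (cases r, cases s) auto
  have q0: "q > 1" using q_prime prime_gt_1_nat by blast
  have pos: "c' > 0" "split_prod T' > 0" using c q0 split_prod_pos[OF T(2)] by auto
  have nz: "(of_int (\<epsilon>' * split_prod T') :: rat) \<noteq> 0" "(of_int (\<epsilon>' * c') :: rat) \<noteq> 0"
    using e pos by auto
  have eq1: "square_class (ring_of_type_algebra :: rat ring) (of_int (\<epsilon> * split_prod T))
        = square_class ring_of_type_algebra (of_int (\<epsilon>' * split_prod T'))"
    and eq2: "square_class (ring_of_type_algebra :: rat ring) (of_int (\<epsilon> * c))
        = square_class ring_of_type_algebra (of_int (\<epsilon>' * c'))"
    using eq by (auto simp: representative_def r s)
  have "\<epsilon> = \<epsilon>'"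
    using square_class_rat_eqD(1)[OF eq2 nz(2)] e c q0 by auto
  moreover have "c = c'"
    using square_class_rat_eqD(2)[OF eq2 nz(2) q_prime] val_c[OF q_prime c(1) e(1)]
      val_c[OF q_prime c(2) e(2)] c by (auto split: if_splits)
  moreover have "p \<in> T \<longleftrightarrow> p \<in> T'" for p
  proof (cases "p \<in> split_primes")
    case True
    then have p: "Factorial_Ring.prime p" using split_primesD by blast
    show ?thesis
      using square_class_rat_eqD(2)[OF eq1 nz(1) p] val_representative[OF p T(1) e(1)]
        val_representative[OF p T(2) e(2)] by (auto split: if_splits)
  qed (use T in auto)
  ultimately show "r = s" by (auto simp: r s)
qed

lemma selmer2_eq: "selmer2 0 1 (- (of_nat n)\<^sup>2) = representative ` representatives"
proof (intro equalityI subsetI)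
  have N: "(of_nat n :: rat) = of_int (int n)" by simp
  fix z assume "z \<in> selmer2 0 1 (- (of_nat n)\<^sup>2)"
  then obtain b1 b2 :: rat where z: "z = (square_class ring_of_type_algebra b1, square_class ring_of_type_algebra b2)"
    and b: "b1 \<noteq> 0" "b2 \<noteq> 0"
    and loc: "\<And>p. Factorial_Ring.prime p \<Longrightarrow>
      selmer_local (Qp p) (Qp_of_rat p) 0 1 (- (of_int (int n) ^ 2)) b1 b2"
    and real: "selmer_local (ring_of_type_algebra :: real ring) of_rat 0 1 (- (of_int (int n) ^ 2)) b1 b2"
    unfolding selmer2_def N by blast
  \<comment> \<open>The three parameters are read off from the sign of b1, its parities at the split
    primes, and the parity of b2 at q. One sign serves both components because the real place ties
    them together.\<close>
  define \<epsilon> :: int where "\<epsilon> = (if b1 > 0 then 1 else -1)"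
  define T where "T = {p \<in> split_primes. odd (padic_val p b1)}"
  define c where "c = (if odd (padic_val q b2) then int q else 1)"
  have e: "\<epsilon> \<in> {1, -1}" and T: "T \<subseteq> split_primes" and c: "c \<in> {1, int q}"
    by (auto simp: \<epsilon>_def T_def c_def)
  have sgn: "b1 > 0 \<longleftrightarrow> b2 > 0" by (rule selmer_local_real_sign[OF real])
  have q0: "q > 0" using q_prime prime_gt_0_nat by blast
  have pos: "(of_int c :: rat) > 0" "(of_int (split_prod T) :: rat) > 0"
    using c q0 split_prod_pos[OF T] by auto
  have "square_class ring_of_type_algebra b1 = square_class ring_of_type_algebra (of_int (\<epsilon> * split_prod T))"
  proof (rule square_class_rat_eqI)
    show "b1 * of_int (\<epsilon> * split_prod T) > 0"
      using b pos unfolding of_int_mult by (auto simp: \<epsilon>_def zero_less_mult_iff)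
    show "even (padic_val p b1 + padic_val p (of_int (\<epsilon> * split_prod T)))"
      if p: "Factorial_Ring.prime p" for p
      using selmer_even_val(1)[OF loc[OF p] b p] val_representative[OF p T e]
      by (auto simp: T_def split: if_splits)
  qed
  moreover have "square_class ring_of_type_algebra b2 = square_class ring_of_type_algebra (of_int (\<epsilon> * c))"
  proof (rule square_class_rat_eqI)
    show "b2 * of_int (\<epsilon> * c) > 0"
      using b pos sgn unfolding of_int_mult by (auto simp: \<epsilon>_def zero_less_mult_iff)
    show "even (padic_val p b2 + padic_val p (of_int (\<epsilon> * c)))"
      if p: "Factorial_Ring.prime p" for p
      using selmer_even_val(2)[OF loc[OF p] b p] val_c[OF p c e] prime_gt_1_nat[OF q_prime]
      by (auto simp: c_def split: if_splits)
  qed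
  ultimately show "z \<in> representative ` representatives"
    using e T c by (intro image_eqI[of _ _ "(\<epsilon>, T, c)"]) (auto simp: z representative_def)
next
  have N: "(of_nat n :: rat) = of_int (int n)" by simp
  fix z assume "z \<in> representative ` representatives"
  then obtain \<epsilon> T c where z: "z = representative (\<epsilon>, T, c)"
    and e: "\<epsilon> \<in> {1, -1}" and T: "T \<subseteq> split_primes" and c: "c \<in> {1, int q}" by auto
  define b1 b2 :: rat where "b1 = of_int (\<epsilon> * split_prod T)" and "b2 = of_int (\<epsilon> * c)"
  have q0: "q > 0" using q_prime prime_gt_0_nat by blast
  have "(of_int c :: rat) > 0" "(of_int (split_prod T) :: rat) > 0"
    using c q0 split_prod_pos[OF T] by auto
  then have "(of_int \<epsilon> * of_int \<epsilon> :: rat) * (of_int (split_prod T) * of_int c) > 0"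
    using e by auto
  then have b: "b1 * b2 > 0" unfolding b1_def b2_def of_int_mult by (simp only: mult_ac)
  then have nz: "b1 \<noteq> 0" "b2 \<noteq> 0" by auto
  have "selmer_local (Qp p) (Qp_of_rat p) 0 1 (- (of_int (int n) ^ 2)) b1 b2"
    if "Factorial_Ring.prime p" for p
    unfolding b1_def b2_def by (rule selmer_local_representative[OF e T c that])
  moreover have "selmer_local (ring_of_type_algebra :: real ring) of_rat 0 1 (- (of_int (int n) ^ 2)) b1 b2"
    using n_pos b by (intro selmer_local_realI) auto
  moreover have "z = (square_class ring_of_type_algebra b1, square_class ring_of_type_algebra b2)"
    by (simp add: z representative_def b1_def b2_def)
  ultimately show "z \<in> selmer2 0 1 (- (of_nat n)\<^sup>2)"
    unfolding selmer2_def N using nz by blast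
qed

text \<open>The factor 4 from \<open>\<epsilon>\<close> and \<open>c\<close> is the order of the
  image of the 2-torsion: for empty \<open>T\<close> the nontrivial pairs (-1, -1), (1, q) and (-1,
  -q) are the classes of (0, 0), (1, 0) and (-n^2, 0).\<close>

lemma card_selmer2: "card (selmer2 0 1 (- (of_nat n)\<^sup>2)) = 2 ^ (2 + card split_primes)"
proof -
  have "int q \<noteq> 1" using prime_gt_1_nat[OF q_prime] by simp
  then have "card representatives = 2 * (2 ^ card split_primes * 2)"
    by (simp add: card_cartesian_product card_Pow finite_split_primes)
  then show ?thesis by (simp add: selmer2_eq card_image[OF inj_representative])
qed

lemma card_split_primes: "card split_primes = Omega 1 n + Omega 5 n"
proof -
  have "p mod 4 = 1 \<longleftrightarrow> p mod 8 = 1 \<or> p mod 8 = 5" for p :: nat by presburger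
  then have "split_primes = {p \<in> prime_factors n. p mod 8 = 1} \<union> {p \<in> prime_factors n. p mod 8 = 5}"
    by (auto simp: split_primes_def)
  then show ?thesis
    unfolding Omega_def by (simp add: card_Un_disjoint disjoint_iff)
qed

lemma s2_eq: "s2 n = card split_primes"
  unfolding s2_def selmer2_rank_def card_selmer2 by (rule the_equality) simp_all

end

theorem theorem1p2:
  fixes n q :: nat
  assumes "n > 0" and "squarefree n" and "even n"
    and "Factorial_Ring.prime q" and "n\<^sup>2 + 1 = q"
  shows "s2 n = Omega 1 n + Omega 5 n"
proof -
  interpret en_curve n q by unfold_locales (fact assms)+
  show ?thesis by (simp add: s2_eq card_split_primes)
qed

end
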